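(* Let $X$ and $Y$ be finite $T_0$-spaces, and let $X\oplus Y$ be their non-Hausdorff join. Then: (i) $X\oplus Y$ is homotopically trivial if $X$ or $Y$ is homotopically trivial. (ii) $X\oplus Y$ is $\gamma$-collapsible if $X$ or $Y$ is $\gamma$-collapsible.
   Context: Finite $T_0$-spaces are identified with finite posets: for a finite $T_0$-space $X$, $U_x$ denotes the intersection of all open sets containing $x$, and $x\le y$ if and only if $x\in U_y$; the open sets are the down-sets. The (non-Hausdorff) join $X\oplus Y$ is the disjoint union $X\sqcup Y$ keeping the given ordering within $X$ and $Y$ and setting $x\le y$ for every $x\in X$ and $y\in Y$. For a point $x\in X$, the link $\hat{C}_x$ is the subspace of points of $X$ different from $x$ and comparable with $x$. A space is homotopically trivial if all its homotopy groups are trivial (in particular it is non-empty and path-connected). A point $x\in X$ is a $\gamma$-point if $\hat{C}_x$ is homotopically trivial; in that case there is an elementary $\gamma$-collapse from $X$ to $X\smallsetminus\{x\}$. A finite $T_0$-space $X$ $\gamma$-collapses to $Y$ if there is a (finite) sequence of elementary $\gamma$-collapses that starts in $X$ and ends in $Y$. $X$ is $\gamma$-collapsible if it $\gamma$-collapses to a point. *)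

theory Defs
  imports "HOL-Analysis.Analysis" "HOL-Algebra.Elementary_Groups"
begin

section \<open>Homotopy groups\<close>

text \<open>
  A point of the \<open>n\<close>-cube is an extensional function \<open>s\<close> on the indices \<open>0, \<dots>, n - 1\<close>.
\<close>

definition cube :: "nat \<Rightarrow> (nat \<Rightarrow> real) topology" where
  "cube n = product_topology (\<lambda>_. top_of_set {0..1}) {..<n}"

definition cube_boundary :: "nat \<Rightarrow> (nat \<Rightarrow> real) set" where
  "cube_boundary n = {s \<in> topspace (cube n). \<exists>i<n. s i = 0 \<or> s i = 1}"

definition spheroids :: "nat \<Rightarrow> 'a topology \<Rightarrow> 'a \<Rightarrow> ((nat \<Rightarrow> real) \<Rightarrow> 'a) set" where
  "spheroids n X x = {f. continuous_map (cube n) X f \<and> (\<forall>s \<in> cube_boundary n. f s = x)}"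

definition homotopic_spheroids ::
    "nat \<Rightarrow> 'a topology \<Rightarrow> 'a \<Rightarrow> ((nat \<Rightarrow> real) \<Rightarrow> 'a) \<Rightarrow> ((nat \<Rightarrow> real) \<Rightarrow> 'a) \<Rightarrow> bool" where
  "homotopic_spheroids n X x = homotopic_with (\<lambda>h. \<forall>s \<in> cube_boundary n. h s = x) (cube n) X"

definition spheroid_class ::
    "nat \<Rightarrow> 'a topology \<Rightarrow> 'a \<Rightarrow> ((nat \<Rightarrow> real) \<Rightarrow> 'a) \<Rightarrow> ((nat \<Rightarrow> real) \<Rightarrow> 'a) set" where
  "spheroid_class n X x f = {g. homotopic_spheroids n X x f g}"

definition spheroid_concat ::
    "((nat \<Rightarrow> real) \<Rightarrow> 'a) \<Rightarrow> ((nat \<Rightarrow> real) \<Rightarrow> 'a) \<Rightarrow> (nat \<Rightarrow> real) \<Rightarrow> 'a" where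
  "spheroid_concat f g = (\<lambda>s. if s 0 \<le> 1/2 then f (s(0 := 2 * s 0)) else g (s(0 := 2 * s 0 - 1)))"

text \<open>
  The group \<open>\<pi>\<^sub>n(X, x)\<close>, meaningful for \<open>n \<ge> 1\<close>.  The product of two classes is the union of
  the classes of all concatenations of representatives; these classes coincide.
\<close>

definition homotopy_group ::
    "nat \<Rightarrow> 'a topology \<Rightarrow> 'a \<Rightarrow> ((nat \<Rightarrow> real) \<Rightarrow> 'a) set monoid" where
  "homotopy_group n X x =
     \<lparr>carrier = spheroid_class n X x ` spheroids n X x,
      mult = (\<lambda>A B. \<Union>f\<in>A. \<Union>g\<in>B. spheroid_class n X x (spheroid_concat f g)),
      one = spheroid_class n X x (\<lambda>_. x)\<rparr>"

text \<open>
  The first two conjuncts say that \<open>\<pi>\<^sub>0\<close>, which is only a set, is a singleton.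
\<close>

definition homotopically_trivial :: "'a topology \<Rightarrow> bool" where
  "homotopically_trivial X \<longleftrightarrow>
     topspace X \<noteq> {} \<and> path_connected_space X \<and>
     (\<forall>x \<in> topspace X. \<forall>n\<ge>1. trivial_group (homotopy_group n X x))"

section \<open>Finite \<open>T\<^sub>0\<close>-spaces as posets\<close>

definition finite_t0_space :: "'a topology \<Rightarrow> bool" where
  "finite_t0_space X \<longleftrightarrow> finite (topspace X) \<and> t0_space X"

text \<open>\<open>U\<^sub>x\<close>; only used for \<open>x\<close> in the space.\<close>

definition min_open :: "'a topology \<Rightarrow> 'a \<Rightarrow> 'a set" where
  "min_open X x = \<Inter>{U. openin X U \<and> x \<in> U}"

definition space_le :: "'a topology \<Rightarrow> 'a \<Rightarrow> 'a \<Rightarrow> bool" where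
  "space_le X x y \<longleftrightarrow> y \<in> topspace X \<and> x \<in> min_open X y"

lemma space_le_refl: "x \<in> topspace X \<Longrightarrow> space_le X x x"
  by (auto simp: space_le_def min_open_def)

lemma space_le_in_topspace: "space_le X x y \<Longrightarrow> x \<in> topspace X \<and> y \<in> topspace X"
  by (auto simp: space_le_def min_open_def)

lemma space_le_trans: "space_le X x y \<Longrightarrow> space_le X y z \<Longrightarrow> space_le X x z"
  by (auto simp: space_le_def min_open_def)

section \<open>The non-Hausdorff join\<close>

fun join_le :: "'a topology \<Rightarrow> 'b topology \<Rightarrow> 'a + 'b \<Rightarrow> 'a + 'b \<Rightarrow> bool" where
  "join_le X Y (Inl x) (Inl x') \<longleftrightarrow> space_le X x x'"
| "join_le X Y (Inr y) (Inr y') \<longleftrightarrow> space_le Y y y'"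
| "join_le X Y (Inl x) (Inr y) \<longleftrightarrow> x \<in> topspace X \<and> y \<in> topspace Y"
| "join_le X Y (Inr y) (Inl x) \<longleftrightarrow> False"

definition join_open :: "'a topology \<Rightarrow> 'b topology \<Rightarrow> ('a + 'b) set \<Rightarrow> bool" where
  "join_open X Y D \<longleftrightarrow>
     D \<subseteq> topspace X <+> topspace Y \<and> (\<forall>q\<in>D. \<forall>p. join_le X Y p q \<longrightarrow> p \<in> D)"

definition nh_join :: "'a topology \<Rightarrow> 'b topology \<Rightarrow> ('a + 'b) topology" where
  "nh_join X Y = topology (join_open X Y)"

lemma join_le_in_carrier:
  "join_le X Y p q \<Longrightarrow> p \<in> topspace X <+> topspace Y \<and> q \<in> topspace X <+> topspace Y"
  by (cases p; cases q) (auto dest: space_le_in_topspace)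

lemma join_le_refl: "p \<in> topspace X <+> topspace Y \<Longrightarrow> join_le X Y p p"
  by (auto simp: space_le_refl)

lemma join_le_trans: "join_le X Y p q \<Longrightarrow> join_le X Y q r \<Longrightarrow> join_le X Y p r"
  by (cases p; cases q; cases r) (auto dest: space_le_in_topspace intro: space_le_trans)

lemma openin_nh_join: "openin (nh_join X Y) D \<longleftrightarrow> join_open X Y D"
proof -
  have "istopology (join_open X Y)"
    unfolding istopology_def join_open_def by blast
  then show ?thesis
    by (simp add: nh_join_def topology_inverse')
qed

lemma topspace_nh_join: "topspace (nh_join X Y) = topspace X <+> topspace Y"
proof
  show "topspace (nh_join X Y) \<subseteq> topspace X <+> topspace Y"
    unfolding topspace_def openin_nh_join by (auto simp: join_open_def)
  have "join_open X Y (topspace X <+> topspace Y)"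
    unfolding join_open_def using join_le_in_carrier by blast
  then show "topspace X <+> topspace Y \<subseteq> topspace (nh_join X Y)"
    by (simp add: openin_nh_join openin_subset)
qed

lemma space_le_nh_join: "space_le (nh_join X Y) p q \<longleftrightarrow> join_le X Y p q"
proof
  assume le: "space_le (nh_join X Y) p q"
  have "join_open X Y {r. join_le X Y r q}"
    unfolding join_open_def using join_le_in_carrier join_le_trans by blast
  moreover have "q \<in> {r. join_le X Y r q}"
    using le by (simp add: space_le_def topspace_nh_join join_le_refl)
  ultimately show "join_le X Y p q"
    using le unfolding space_le_def min_open_def openin_nh_join by blast
next
  assume "join_le X Y p q"
  then show "space_le (nh_join X Y) p q"
    unfolding space_le_def min_open_def openin_nh_join topspace_nh_join
    using join_le_in_carrier by (fastforce simp: join_open_def)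
qed

section \<open>\<open>\<gamma>\<close>-collapses\<close>

definition link :: "'a topology \<Rightarrow> 'a \<Rightarrow> 'a topology" where
  "link X x = subtopology X {y \<in> topspace X. y \<noteq> x \<and> (space_le X y x \<or> space_le X x y)}"

definition gamma_point :: "'a topology \<Rightarrow> 'a \<Rightarrow> bool" where
  "gamma_point X x \<longleftrightarrow> x \<in> topspace X \<and> homotopically_trivial (link X x)"

definition elementary_gamma_collapse :: "'a topology \<Rightarrow> 'a topology \<Rightarrow> bool" where
  "elementary_gamma_collapse X Z \<longleftrightarrow>
     (\<exists>x. gamma_point X x \<and> Z = subtopology X (topspace X - {x}))"

definition gamma_collapses :: "'a topology \<Rightarrow> 'a topology \<Rightarrow> bool" where
  "gamma_collapses = elementary_gamma_collapse\<^sup>*\<^sup>*"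

definition gamma_collapsible :: "'a topology \<Rightarrow> bool" where
  "gamma_collapsible X \<longleftrightarrow> (\<exists>Z. gamma_collapses X Z \<and> (\<exists>x. topspace Z = {x}))"

end

theory Submission
  imports Defs
begin

text \<open>
  The proof replaces homotopy groups by extension properties.  A space \<open>Z\<close> is an absolute extensor
  for \<open>M\<close> if every continuous map into \<open>Z\<close> from a closed subset of \<open>M\<close> extends to \<open>M\<close>.  A finite
  \<open>T\<^sub>0\<close>-space is homotopically trivial if and only if it is an absolute extensor for all cubes
  (\<open>homotopically_trivial_imp_absolute_extensor\<close>, \<open>absolute_extensor_imp_homotopically_trivial\<close>),
  and for joins the extension property can be checked by hand.

  Everything rests on one fact: a continuous map from a closed subset \<open>E\<close> of a metrizable space into
  a finite \<open>T\<^sub>0\<close>-space extends to a neighbourhood of \<open>E\<close> (\<open>extends_to_open_neighbourhood\<close>).  The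
  strata \<open>{f = p}\<close> of incomparable points \<open>p\<close> are separated, hence have disjoint open neighbourhoods;
  the strata whose neighbourhoods contain a given point are then indexed by a chain, and the least
  index serves as the value.  The homotopy extension property follows (\<open>homotopy_extension\<close>).

  For the join let \<open>f\<close> be a map from a closed subset of \<open>M\<close> to \<open>X \<oplus> Y\<close>, already extended to a closed
  neighbourhood.  Switching on the closed complement of an open set from a map to a pointwise larger
  one keeps continuity, and every value in \<open>Y\<close> is larger than every value in \<open>X\<close>.  If \<open>Y\<close> is an extensor, extend
  the part of \<open>f\<close> with values in \<open>Y\<close> to a map \<open>g\<close> from \<open>M\<close> to \<open>Y\<close>, and switch from \<open>f\<close> to \<open>g\<close> outside
  a small open neighbourhood (\<open>absolute_extensor_nh_join_right\<close>).  If \<open>X\<close> is an extensor, extend the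
  part of \<open>f\<close> with values in \<open>Y\<close> only to a closed neighbourhood \<open>L\<close> of the preimage of \<open>Y\<close>; outside a
  smaller neighbourhood of that preimage \<open>f\<close> has values in \<open>X\<close> and extends to a map from \<open>M\<close> to \<open>X\<close>,
  which takes over away from \<open>L\<close> (\<open>absolute_extensor_nh_join_left\<close>).

  That homotopically trivial spaces are extensors for cubes is proved without cell decompositions.
  The cube is swept along one coordinate \<open>j\<close>: extensions over single slices exist by induction on the
  dimension, each of them extends to a thin slab, and by completeness of the interval the slabs can be
  glued successively from one end of the cube to the other.  Two extensions over a common slice have to be joined by a homotopy that is fixed
  where the map is prescribed.  This is again an extension problem, in which the slice coordinate has
  become the time of the homotopy.  When all coordinates have become times, what remains is to extend
  a map from the boundary of a cube, and there the vanishing of the homotopy groups enters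
  (\<open>boundary_map_extends_over_cube\<close>, \<open>saturated_map_extends_over_icube\<close>).

  For collapses, the link in \<open>X \<oplus> Y\<close> of a point of \<open>X\<close> is the join of its link in \<open>X\<close> with \<open>Y\<close>, and
  symmetrically.  By the first part, \<open>\<gamma>\<close>-points of \<open>X\<close> remain \<open>\<gamma>\<close>-points of the join, so a collapse
  of \<open>X\<close> to a point \<open>x\<close> collapses \<open>X \<oplus> Y\<close> to \<open>{x} \<oplus> Y\<close>.  There every point of \<open>Y\<close> is a \<open>\<gamma>\<close>-point,
  because \<open>{x}\<close> is homotopically trivial, and \<open>Y\<close> can be removed point by point.
\<close>

section \<open>Continuous maps into finite spaces\<close>

lemma finite_space_finite: "finite_t0_space Z \<Longrightarrow> finite (topspace Z)"
  by (simp add: finite_t0_space_def)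

lemma openin_min_open:
  assumes "finite (topspace Z)" "q \<in> topspace Z"
  shows "openin Z (min_open Z q)"
  unfolding min_open_def
proof (rule openin_Inter)
  show "finite {U. openin Z U \<and> q \<in> U}"
    by (rule finite_subset[of _ "Pow (topspace Z)"]) (use assms openin_subset in auto)
qed (use assms in auto)

lemma min_open_eq_down_set: "q \<in> topspace Z \<Longrightarrow> min_open Z q = {p. space_le Z p q}"
  by (auto simp: space_le_def)

lemma openin_finite_space_iff:
  assumes "finite (topspace Z)"
  shows "openin Z D \<longleftrightarrow> D \<subseteq> topspace Z \<and> (\<forall>q\<in>D. \<forall>p. space_le Z p q \<longrightarrow> p \<in> D)"
proof
  assume "openin Z D"
  then show "D \<subseteq> topspace Z \<and> (\<forall>q\<in>D. \<forall>p. space_le Z p q \<longrightarrow> p \<in> D)"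
    by (auto simp: space_le_def min_open_def dest: openin_subset)
next
  assume D: "D \<subseteq> topspace Z \<and> (\<forall>q\<in>D. \<forall>p. space_le Z p q \<longrightarrow> p \<in> D)"
  show "openin Z D"
  proof (subst openin_subopen, rule ballI)
    fix q assume q: "q \<in> D"
    then show "\<exists>T. openin Z T \<and> q \<in> T \<and> T \<subseteq> D"
      using D openin_min_open[OF assms, of q] min_open_eq_down_set[of q Z] space_le_refl[of q Z]
      by (intro exI[of _ "min_open Z q"]) auto
  qed
qed

lemma space_le_antisym:
  assumes "finite_t0_space Z" "space_le Z p q" "space_le Z q p"
  shows "p = q"
proof (rule ccontr)
  assume "p \<noteq> q"
  moreover have "p \<in> topspace Z" "q \<in> topspace Z"
    using space_le_in_topspace[OF assms(2)] by auto
  ultimately obtain U where "openin Z U" "p \<notin> U \<longleftrightarrow> q \<in> U"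
    using assms(1) unfolding finite_t0_space_def t0_space_def by blast
  then show False
    using assms(2,3) unfolding space_le_def min_open_def by auto
qed

lemma continuous_map_into_finite_space:
  assumes "finite (topspace Z)"
  shows "continuous_map M Z f \<longleftrightarrow>
    f \<in> topspace M \<rightarrow> topspace Z \<and>
    (\<forall>q\<in>topspace Z. openin M {s \<in> topspace M. space_le Z (f s) q})"
proof (intro iffI conjI ballI)
  assume f: "continuous_map M Z f"
  then show "f \<in> topspace M \<rightarrow> topspace Z"
    by (rule continuous_map_funspace)
  fix q assume q: "q \<in> topspace Z"
  show "openin M {s \<in> topspace M. space_le Z (f s) q}"
    using openin_continuous_map_preimage[OF f openin_min_open[OF assms q]]
    by (simp add: min_open_eq_down_set[OF q])
next
  assume f: "f \<in> topspace M \<rightarrow> topspace Z \<and>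
    (\<forall>q\<in>topspace Z. openin M {s \<in> topspace M. space_le Z (f s) q})"
  show "continuous_map M Z f"
    unfolding continuous_map_def
  proof (intro conjI allI impI)
    fix D assume D: "openin Z D"
    have "{s \<in> topspace M. f s \<in> D} = (\<Union>q\<in>D. {s \<in> topspace M. space_le Z (f s) q})"
      using D f space_le_refl[of _ Z] unfolding openin_finite_space_iff[OF assms] by auto
    moreover have "openin M (\<Union>q\<in>D. {s \<in> topspace M. space_le Z (f s) q})"
      using f openin_subset[OF D] by blast
    ultimately show "openin M {s \<in> topspace M. f s \<in> D}" by simp
  qed (use f in auto)
qed

lemma closedin_not_below:
  assumes fin: "finite (topspace Z)" and K: "closedin M K"
    and f: "continuous_map (subtopology M K) Z f" and q: "q \<in> topspace Z"
  shows "closedin M {s \<in> K. \<not> space_le Z (f s) q}"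
proof (rule closedin_trans_full[OF _ K])
  have "openin (subtopology M K) {s \<in> topspace (subtopology M K). space_le Z (f s) q}"
    using f q unfolding continuous_map_into_finite_space[OF fin] by auto
  moreover have "{s \<in> K. \<not> space_le Z (f s) q} =
      topspace (subtopology M K) - {s \<in> topspace (subtopology M K). space_le Z (f s) q}"
    using closedin_subset[OF K] by auto
  ultimately show "closedin (subtopology M K) {s \<in> K. \<not> space_le Z (f s) q}"
    by (metis closedin_diff closedin_topspace)
qed

section \<open>Extension to neighbourhoods\<close>

lemma finite_chain_has_least:
  assumes "finite A" "A \<noteq> {}" "\<And>p. p \<in> A \<Longrightarrow> p \<in> topspace Z"
    and "\<And>p q. p \<in> A \<Longrightarrow> q \<in> A \<Longrightarrow> space_le Z p q \<or> space_le Z q p"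
  shows "\<exists>p\<in>A. \<forall>q\<in>A. space_le Z p q"
  using assms
proof (induction A rule: finite_ne_induct)
  case (singleton x)
  then show ?case by (auto intro: space_le_refl)
next
  case (insert x F)
  then obtain p where p: "p \<in> F" "\<forall>q\<in>F. space_le Z p q" by auto
  have "space_le Z x x" using insert.prems by (auto intro: space_le_refl)
  moreover have "space_le Z p x \<or> space_le Z x p" using insert.prems(2)[of p x] p(1) by auto
  ultimately show ?case using p space_le_trans[of Z x p] by blast
qed

text \<open>
  The value of the extension at \<open>s\<close> is the least \<open>p\<close> such that \<open>s\<close> lies in a suitable open
  neighbourhood of the stratum \<open>{f = p}\<close>.  Such a \<open>p\<close> exists because the neighbourhoods of strata over
  incomparable points are disjoint.  The preimage of a down-set is the union of the neighbourhoods
  indexed by it, which gives continuity.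
\<close>

lemma extends_to_open_neighbourhood:
  assumes M: "metrizable_space M" and Z: "finite_t0_space Z" and E: "closedin M E"
    and f: "continuous_map (subtopology M E) Z f"
  obtains N g where "openin M N" "E \<subseteq> N" "continuous_map (subtopology M N) Z g"
    "\<And>s. s \<in> E \<Longrightarrow> g s = f s"
proof -
  have fin: "finite (topspace Z)" using Z by (rule finite_space_finite)
  have EM: "E \<subseteq> topspace M" using E by (rule closedin_subset)
  have fE: "f s \<in> topspace Z" if "s \<in> E" for s
    using continuous_map_image_subset_topspace[OF f] EM that by auto
  \<comment> \<open>The strata, and the closed part of \<open>E\<close> that the neighbourhood of the stratum of \<open>p\<close> must avoid
    for the extension to agree with \<open>f\<close> on \<open>E\<close>.\<close>
  define S where "S p = {s \<in> E. f s = p}" for p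
  define L where "L p = {s \<in> E. \<not> space_le Z (f s) p}" for p
  have clL: "closedin M (L p)" if "p \<in> topspace Z" for p
    unfolding L_def using fin E f that by (rule closedin_not_below)
  define inc where "inc p q \<longleftrightarrow> p \<in> topspace Z \<and> q \<in> topspace Z \<and> \<not> space_le Z p q \<and> \<not> space_le Z q p" for p q
  have sep: "separatedin M (S p) (S q)" if pq: "inc p q" for p q
  proof -
    have cl: "M closure_of S a \<inter> S b = {}" if "inc a b" for a b
    proof -
      have "S a \<subseteq> L b" using that by (auto simp: S_def L_def inc_def)
      then have "M closure_of S a \<subseteq> L b"
        by (rule closure_of_minimal) (use clL that inc_def in auto)
      moreover have "L b \<inter> S b = {}" using space_le_refl[of b Z] that
        by (auto simp: S_def L_def inc_def)
      ultimately show ?thesis by blast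
    qed
    have "inc q p" using pq by (auto simp: inc_def)
    then show ?thesis using cl[OF pq] cl[of q p] EM unfolding separatedin_def by (auto simp: S_def)
  qed
  have "\<forall>p q. \<exists>U V. inc p q \<longrightarrow> openin M U \<and> openin M V \<and> S p \<subseteq> U \<and> S q \<subseteq> V \<and> disjnt U V"
    by (metis metrizable_space_separation[OF M sep])
  then obtain U V where UV: "\<And>p q. inc p q \<Longrightarrow>
      openin M (U p q) \<and> openin M (V p q) \<and> S p \<subseteq> U p q \<and> S q \<subseteq> V p q \<and> disjnt (U p q) (V p q)"
    by metis
  \<comment> \<open>Intersecting the separating sets for \<open>(p, q)\<close> and \<open>(q, p)\<close> makes the choice symmetric, so that
    \<open>W p q\<close> and \<open>W q p\<close> are disjoint.\<close>
  define W where "W p q = (if inc p q then U p q \<inter> V q p else topspace M)" for p q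
  have inc_sym: "inc p q \<Longrightarrow> inc q p" for p q by (auto simp: inc_def)
  have opW: "openin M (W p q)" for p q
    using UV[of p q] UV[of q p] inc_sym[of p q] by (auto simp: W_def)
  have SW: "S p \<subseteq> W p q" for p q
    using UV[of p q] UV[of q p] inc_sym[of p q] EM by (auto simp: W_def S_def)
  have WW: "W p q \<inter> W q p = {}" if "inc p q" for p q
    using UV[OF that] inc_sym[OF that] that unfolding W_def disjnt_def by auto
  define Op where "Op p = (\<Inter>q\<in>topspace Z. W p q) \<inter> topspace M - L p" for p
  have opOp: "openin M (Op p)" if "p \<in> topspace Z" for p
    unfolding Op_def using fin opW clL[OF that] by (intro openin_diff openin_INT) auto
  have SOp: "S p \<subseteq> Op p" if "p \<in> topspace Z" for p
    using SW[of p] EM space_le_refl[OF that] unfolding Op_def by (auto simp: S_def L_def)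
  define A where "A s = {p \<in> topspace Z. s \<in> Op p}" for s
  define N where "N = (\<Union>p\<in>topspace Z. Op p)"
  define g where "g s = (SOME p. p \<in> A s \<and> (\<forall>q\<in>A s. space_le Z p q))" for s
  have g: "g s \<in> A s \<and> (\<forall>q\<in>A s. space_le Z (g s) q)" if "s \<in> N" for s
    unfolding g_def
  proof (rule someI_ex)
    have "\<exists>p\<in>A s. \<forall>q\<in>A s. space_le Z p q"
    proof (rule finite_chain_has_least)
      show "finite (A s)" "A s \<noteq> {}" using fin that by (auto simp: A_def N_def)
      show "space_le Z p q \<or> space_le Z q p" if "p \<in> A s" "q \<in> A s" for p q
        using WW[of p q] that unfolding A_def Op_def inc_def by blast
    qed (auto simp: A_def)
    then show "\<exists>p. p \<in> A s \<and> (\<forall>q\<in>A s. space_le Z p q)" by blast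
  qed
  show thesis
  proof
    show opN: "openin M N" unfolding N_def using opOp by blast
    show EN: "E \<subseteq> N" unfolding N_def using SOp fE by (auto simp: S_def)
    have NM: "N \<subseteq> topspace M" using opN by (rule openin_subset)
    show "g s = f s" if s: "s \<in> E" for s
    proof -
      have "f s \<in> A s" using SOp[OF fE[OF s]] fE[OF s] s by (auto simp: A_def S_def)
      then have 1: "space_le Z (g s) (f s)" using g EN s by blast
      have "g s \<in> A s" using g EN s by blast
      then have "s \<notin> L (g s)" by (auto simp: A_def Op_def)
      then have "space_le Z (f s) (g s)" using s by (auto simp: L_def)
      with 1 show ?thesis using space_le_antisym[OF Z] by blast
    qed
    show "continuous_map (subtopology M N) Z g"
      unfolding continuous_map_into_finite_space[OF fin]
    proof (intro conjI ballI)
      show "g \<in> topspace (subtopology M N) \<rightarrow> topspace Z"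
        using g by (auto simp: A_def)
      fix q assume q: "q \<in> topspace Z"
      have "{s \<in> topspace (subtopology M N). space_le Z (g s) q} = N \<inter> (\<Union>p\<in>{p. space_le Z p q}. Op p)"
      proof (intro Set.set_eqI iffI)
        fix s assume "s \<in> {s \<in> topspace (subtopology M N). space_le Z (g s) q}"
        then show "s \<in> N \<inter> (\<Union>p\<in>{p. space_le Z p q}. Op p)"
          using g[of s] by (auto simp: A_def)
      next
        fix s assume "s \<in> N \<inter> (\<Union>p\<in>{p. space_le Z p q}. Op p)"
        then obtain p where s: "s \<in> N" "space_le Z p q" "s \<in> Op p" by auto
        then have "p \<in> A s" using space_le_in_topspace[OF s(2)] by (auto simp: A_def)
        then have "space_le Z (g s) q" using g s space_le_trans by metis
        then show "s \<in> {s \<in> topspace (subtopology M N). space_le Z (g s) q}" using s NM by auto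
      qed
      moreover have "openin M (\<Union>p\<in>{p. space_le Z p q}. Op p)"
        using opOp space_le_in_topspace by (intro openin_Union) fastforce
      ultimately show "openin (subtopology M N) {s \<in> topspace (subtopology M N). space_le Z (g s) q}"
        by (simp add: openin_subtopology_Int2)
    qed
  qed
qed

lemma extends_to_closed_neighbourhood:
  assumes M: "metrizable_space M" and Z: "finite_t0_space Z" and E: "closedin M E"
    and f: "continuous_map (subtopology M E) Z f"
  obtains N K g where "openin M N" "closedin M K" "E \<subseteq> N" "N \<subseteq> K"
    "continuous_map (subtopology M K) Z g" "\<And>s. s \<in> E \<Longrightarrow> g s = f s"
proof -
  obtain N g where N: "openin M N" "E \<subseteq> N" "continuous_map (subtopology M N) Z g"
    "\<And>s. s \<in> E \<Longrightarrow> g s = f s"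
    using extends_to_open_neighbourhood[OF assms] by blast
  obtain V where V: "openin M V" "E \<subseteq> V" "M closure_of V \<subseteq> N"
    using metrizable_imp_normal_space[OF M, unfolded normal_space_alt, rule_format, of E N] E N(1,2)
    by auto
  show thesis
  proof
    show "V \<subseteq> M closure_of V" using V(1) by (simp add: closure_of_subset openin_subset)
    show "continuous_map (subtopology M (M closure_of V)) Z g"
      using continuous_map_from_subtopology_mono[OF N(3) V(3)] .
  qed (use V N in auto)
qed

lemma continuous_map_paste_closed:
  assumes S: "closedin X S" and T: "closedin X T" and cover: "topspace X \<subseteq> S \<union> T"
    and f: "continuous_map (subtopology X S) Y f" and g: "continuous_map (subtopology X T) Y g"
    and agree: "\<And>x. x \<in> S \<Longrightarrow> x \<in> T \<Longrightarrow> f x = g x"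
  shows "continuous_map X Y (\<lambda>x. if x \<in> S then f x else g x)"
proof (rule pasting_lemma_closed[where I="UNIV::bool set" and T="\<lambda>b. if b then S else T"
        and f="\<lambda>b. if b then f else g"])
  show "\<exists>j. j \<in> UNIV \<and> x \<in> (if j then S else T) \<and> (if x \<in> S then f x else g x) = (if j then f else g) x"
    if "x \<in> topspace X" for x
    using that cover by (intro exI[of _ "x \<in> S"]) auto
qed (use assms in auto)

section \<open>The homotopy extension property\<close>

abbreviation unit_interval :: "real topology" where
  "unit_interval \<equiv> top_of_set {0..1}"

lemma metrizable_unit_interval: "metrizable_space unit_interval"
  by (simp add: metrizable_space_euclidean metrizable_space_subtopology)

text \<open>
  The prescribed map on \<open>{0} \<times> M \<union> {0..1} \<times> E\<close> extends to an open neighbourhood, which by compactness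
  of the interval contains \<open>{0..1} \<times> U\<close> for an open \<open>U\<close> around \<open>E\<close>.  Slowing down the time by a Urysohn
  function \<open>u\<close> that is \<open>1\<close> on \<open>E\<close> and \<open>0\<close> outside \<open>U\<close> keeps all arguments in that neighbourhood.
\<close>

lemma homotopy_extension:
  assumes M: "metrizable_space M" and Z: "finite_t0_space Z" and E: "closedin M E"
    and F: "continuous_map M Z F"
    and h: "continuous_map (prod_topology unit_interval (subtopology M E)) Z h"
    and h0: "\<And>s. s \<in> E \<Longrightarrow> h (0, s) = F s"
  obtains H where "continuous_map (prod_topology unit_interval M) Z H"
    "\<And>s. s \<in> topspace M \<Longrightarrow> H (0, s) = F s"
    "\<And>t s. t \<in> {0..1} \<Longrightarrow> s \<in> E \<Longrightarrow> H (t, s) = h (t, s)"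
proof -
  let ?IM = "prod_topology unit_interval M"
  have EM: "E \<subseteq> topspace M" using E by (rule closedin_subset)
  have IM: "metrizable_space ?IM"
    using M metrizable_unit_interval by (simp add: metrizable_space_prod_topology)
  define B where "B = ({0..1::real} \<times> E) \<union> ({0} \<times> topspace M)"
  have cl1: "closedin ?IM ({0..1} \<times> E)" and cl0: "closedin ?IM ({0} \<times> topspace M)"
    using E by (auto simp: closedin_prod_Times_iff)
  have B: "closedin ?IM B" unfolding B_def using cl0 cl1 by (rule closedin_Un[rotated])
  define k where "k x = (if x \<in> {0..1} \<times> E then h x else (F \<circ> snd) x)" for x
  have "continuous_map (subtopology ?IM B) Z (\<lambda>x. if x \<in> {0..1} \<times> E then h x else (F \<circ> snd) x)"
  proof (rule continuous_map_paste_closed)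
    show "closedin (subtopology ?IM B) ({0..1} \<times> E)" 
      using cl1 by (rule closedin_subset_topspace) (auto simp: B_def)
    show "closedin (subtopology ?IM B) ({0} \<times> topspace M)"
      using cl0 by (rule closedin_subset_topspace) (auto simp: B_def)
    show "topspace (subtopology ?IM B) \<subseteq> ({0..1} \<times> E) \<union> ({0} \<times> topspace M)"
      by (auto simp: B_def)
    have "B \<inter> {0..1} \<times> E = {0..1} \<times> E" by (auto simp: B_def)
    then have "subtopology (subtopology ?IM B) ({0..1} \<times> E) = prod_topology unit_interval (subtopology M E)"
      by (simp only: subtopology_subtopology subtopology_Times Int_absorb)
    then show "continuous_map (subtopology (subtopology ?IM B) ({0..1} \<times> E)) Z h" using h by simp
    show "continuous_map (subtopology (subtopology ?IM B) ({0} \<times> topspace M)) Z (F \<circ> snd)"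
      by (intro continuous_map_from_subtopology continuous_map_compose[OF continuous_map_snd F])
  qed (use h0 in auto)
  then have k: "continuous_map (subtopology ?IM B) Z k" by (simp add: k_def[abs_def])
  obtain N g where N: "openin ?IM N" "B \<subseteq> N" "continuous_map (subtopology ?IM N) Z g"
    and gk: "\<And>x. x \<in> B \<Longrightarrow> g x = k x"
    using extends_to_open_neighbourhood[OF IM Z B k] by blast
  \<comment> \<open>The points of \<open>M\<close> over which the neighbourhood misses some time.\<close>
  define T where "T = snd ` (topspace ?IM - N)"
  have T: "closedin M T"
  proof -
    have "closed_map ?IM M snd"
      by (rule Abstract_Topological_Spaces.closed_map_snd) (simp add: compact_space_subtopology)
    then show ?thesis unfolding T_def closed_map_def using closedin_diff[OF closedin_topspace N(1)] by blast
  qed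
  have disj: "disjnt E T" using N(2) unfolding T_def disjnt_def B_def by auto
  obtain u where u: "continuous_map M unit_interval u" "u ` T \<subseteq> {0}" "u ` E \<subseteq> {1}"
    by (rule Urysohn_lemma[OF metrizable_imp_normal_space[OF M] T E, of 0 1])
      (use disj disjnt_sym in auto)
  have u01: "u s \<in> {0..1}" if "s \<in> topspace M" for s
    using continuous_map_image_subset_topspace[OF u(1)] that by auto
  have tu: "t * u s \<in> {0..1}" if "t \<in> {0..1}" "s \<in> topspace M" for t s
    using u01[OF that(2)] that(1) mult_le_one[of t "u s"] by simp
  define r where "r x = (fst x * u (snd x), snd x)" for x :: "real \<times> 'a"
  have uI: "continuous_map ?IM euclideanreal (\<lambda>x. u (snd x))"
    using continuous_map_compose[OF continuous_map_snd[of unit_interval M] u(1)]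
    by (auto simp: o_def continuous_map_in_subtopology)
  have fstI: "continuous_map ?IM euclideanreal fst"
    using continuous_map_fst[of unit_interval M] by (auto simp: continuous_map_in_subtopology)
  have r: "continuous_map ?IM (subtopology ?IM N) r"
    unfolding continuous_map_in_subtopology
  proof
    show "continuous_map ?IM ?IM r"
      unfolding r_def
    proof (rule continuous_map_pairedI)
      show "continuous_map ?IM unit_interval (\<lambda>x. fst x * u (snd x))"
        unfolding continuous_map_in_subtopology
        using continuous_map_real_mult[OF fstI uI] tu by auto
    qed (rule continuous_map_snd)
    show "r \<in> topspace ?IM \<rightarrow> N"
    proof
      fix x assume x: "x \<in> topspace ?IM"
      then obtain t s where ts: "x = (t, s)" "t \<in> {0..1}" "s \<in> topspace M" by auto
      show "r x \<in> N"
      proof (cases "s \<in> T")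
        case True
        then have "r x = (0, s)" using u(2) ts by (auto simp: r_def)
        then show ?thesis using N(2) ts by (auto simp: B_def)
      next
        case False
        have "r x \<in> topspace ?IM" using tu ts by (auto simp: r_def)
        moreover have "snd (r x) = s" using ts by (simp add: r_def)
        ultimately show ?thesis using False unfolding T_def by force
      qed
    qed
  qed
  show thesis
  proof
    show "continuous_map ?IM Z (g \<circ> r)" by (rule continuous_map_compose[OF r N(3)])
    show "(g \<circ> r) (0, s) = F s" if "s \<in> topspace M" for s
      using that gk[of "(0,s)"] h0 by (auto simp: r_def B_def k_def)
    show "(g \<circ> r) (t, s) = h (t, s)" if "t \<in> {0..1}" "s \<in> E" for t s
    proof -
      have "u s = 1" using u(3) that by auto
      then show ?thesis using that gk[of "(t,s)"] by (auto simp: r_def B_def k_def)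
    qed
  qed
qed

definition has_extension :: "'m topology \<Rightarrow> 'm set \<Rightarrow> 'z topology \<Rightarrow> ('m \<Rightarrow> 'z) \<Rightarrow> bool" where
  "has_extension M E Z f \<longleftrightarrow> (\<exists>F. continuous_map M Z F \<and> (\<forall>s\<in>E. F s = f s))"

text \<open>
  This allows a map to be replaced by a more convenient homotopic one before it is extended.
\<close>

lemma has_extension_homotopic:
  assumes M: "metrizable_space M" and Z: "finite_t0_space Z" and E: "closedin M E"
    and fg: "homotopic_with (\<lambda>_. True) (subtopology M E) Z f g"
    and f: "has_extension M E Z f"
  shows "has_extension M E Z g"
proof -
  obtain F where F: "continuous_map M Z F" "\<And>s. s \<in> E \<Longrightarrow> F s = f s"
    using f unfolding has_extension_def by blast
  obtain h where h: "continuous_map (prod_topology unit_interval (subtopology M E)) Z h"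
    "\<And>s. h (0, s) = f s" "\<And>s. h (1, s) = g s"
    using fg unfolding homotopic_with_def by auto
  obtain H where H: "continuous_map (prod_topology unit_interval M) Z H"
    "\<And>t s. t \<in> {0..1} \<Longrightarrow> s \<in> E \<Longrightarrow> H (t, s) = h (t, s)"
    using homotopy_extension[OF M Z E F(1) h(1)] h(2) F(2) by metis
  have "continuous_map M Z (H \<circ> Pair 1)"
    by (rule continuous_map_o_Pair[OF H(1)]) simp
  then show ?thesis
    unfolding has_extension_def using H(2)[of 1] h(3) by (intro exI[of _ "H \<circ> Pair 1"]) simp
qed

section \<open>Cubes and their faces\<close>

text \<open>
  Cubes are indexed by arbitrary sets of coordinates, so that a slice of a cube orthogonal to the
  coordinate \<open>j\<close> is again a cube, with \<open>j\<close> removed from the index set.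
\<close>

definition icube :: "nat set \<Rightarrow> (nat \<Rightarrow> real) topology" where
  "icube A = product_topology (\<lambda>_. unit_interval) A"

definition faces :: "nat set \<Rightarrow> nat set \<Rightarrow> (nat \<Rightarrow> real) set" where
  "faces A K = {s \<in> topspace (icube A). \<exists>i\<in>K. s i = 0 \<or> s i = 1}"

lemma cube_eq_icube: "cube n = icube {..<n}"
  by (simp add: cube_def icube_def)

lemma cube_boundary_eq_faces: "cube_boundary n = faces {..<n} {..<n}"
  by (auto simp: cube_boundary_def faces_def cube_eq_icube)

lemma topspace_icube: "topspace (icube A) = A \<rightarrow>\<^sub>E {0..1}"
  by (simp add: icube_def)

lemma metrizable_icube: "metrizable_space (icube A)"
  unfolding icube_def metrizable_space_product_topology
  using metrizable_unit_interval by (auto intro: countable_subset[of _ UNIV])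

lemma compact_icube: "compact_space (icube A)"
  unfolding icube_def by (simp add: compact_space_product_topology compact_space_subtopology)

lemma continuous_map_icube_coordinate:
  "i \<in> A \<Longrightarrow> continuous_map (icube A) euclideanreal (\<lambda>s. s i)"
  unfolding icube_def
  using continuous_map_product_coordinates[of i A "\<lambda>_. unit_interval"]
  by (simp add: continuous_map_in_subtopology)

lemma continuous_map_into_icube:
  assumes "\<And>i. i \<in> A \<Longrightarrow> continuous_map M euclideanreal (\<lambda>x. f x i)"
    and "\<And>x. x \<in> topspace M \<Longrightarrow> f x \<in> A \<rightarrow>\<^sub>E {0..1}"
  shows "continuous_map M (icube A) f"
  unfolding icube_def continuous_map_componentwise continuous_map_in_subtopology
  using assms by (fastforce simp: PiE_def Pi_def)

lemma continuous_map_snd_coordinate: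
  assumes "i \<in> A"
  shows "continuous_map (prod_topology unit_interval (subtopology (icube A) S)) euclideanreal (\<lambda>x. snd x i)"
  using continuous_map_compose[OF continuous_map_snd
      continuous_map_from_subtopology[OF continuous_map_icube_coordinate[OF assms]]]
  by (simp add: o_def)

lemma continuous_map_fst_real:
  "continuous_map (prod_topology unit_interval M) euclideanreal fst"
  using continuous_map_fst[of unit_interval M] by (simp add: continuous_map_in_subtopology)

lemma closedin_icube_coordinate:
  assumes "i \<in> A" "closed S"
  shows "closedin (icube A) {s \<in> topspace (icube A). s i \<in> S}"
  by (rule closedin_continuous_map_preimage[OF continuous_map_icube_coordinate]) (use assms in auto)

lemma closedin_faces:
  assumes "finite K" "K \<subseteq> A"
  shows "closedin (icube A) (faces A K)"
proof -
  have "faces A K = (\<Union>i\<in>K. {s \<in> topspace (icube A). s i \<in> {0, 1}})"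
    by (auto simp: faces_def)
  moreover have "closedin (icube A) (\<Union>i\<in>K. {s \<in> topspace (icube A). s i \<in> {0, 1}})"
    using assms closedin_icube_coordinate[of _ A "{0, 1}"]
    by (intro closedin_Union finite_imageI) auto
  ultimately show ?thesis by simp
qed

lemma faces_subset: "faces A K \<subseteq> topspace (icube A)"
  by (auto simp: faces_def)

lemma continuous_map_update_coordinate:
  assumes "i \<in> A"
  shows "c \<in> {0..1} \<Longrightarrow> continuous_map (icube A) (icube A) (\<lambda>s. s(i := c))"
    and "c \<in> {0..1} \<Longrightarrow> continuous_map (icube (A - {i})) (icube A) (\<lambda>s. s(i := c))"
    and "continuous_map (icube A) (icube (A - {i})) (\<lambda>s. s(i := undefined))"
    and "continuous_map (prod_topology unit_interval (subtopology (icube A) S)) (icube A)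
           (\<lambda>x. (snd x)(i := fst x))"
proof -
  show "continuous_map (icube A) (icube A) (\<lambda>s. s(i := c))" if "c \<in> {0..1}"
  proof (rule continuous_map_into_icube)
    show "continuous_map (icube A) euclideanreal (\<lambda>s. (s(i := c)) k)" if "k \<in> A" for k
      using that by (cases "k = i") (auto simp: continuous_map_icube_coordinate)
  qed (use that assms in \<open>auto simp: topspace_icube PiE_def Pi_def extensional_def\<close>)
  show "continuous_map (icube (A - {i})) (icube A) (\<lambda>s. s(i := c))" if "c \<in> {0..1}"
  proof (rule continuous_map_into_icube)
    show "continuous_map (icube (A - {i})) euclideanreal (\<lambda>s. (s(i := c)) k)" if "k \<in> A" for k
      using that by (cases "k = i") (auto simp: continuous_map_icube_coordinate)
  qed (use that assms in \<open>auto simp: topspace_icube PiE_def Pi_def extensional_def\<close>)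
  show "continuous_map (icube A) (icube (A - {i})) (\<lambda>s. s(i := undefined))"
  proof (rule continuous_map_into_icube)
    show "continuous_map (icube A) euclideanreal (\<lambda>s. (s(i := undefined)) k)" if "k \<in> A - {i}" for k
      using that by (cases "k = i") (auto simp: continuous_map_icube_coordinate)
  qed (auto simp: topspace_icube PiE_def Pi_def extensional_def)
  show "continuous_map (prod_topology unit_interval (subtopology (icube A) S)) (icube A)
           (\<lambda>x. (snd x)(i := fst x))"
  proof (rule continuous_map_into_icube)
    show "continuous_map (prod_topology unit_interval (subtopology (icube A) S)) euclideanreal
            (\<lambda>x. ((snd x)(i := fst x)) k)" if "k \<in> A" for k
      using that by (cases "k = i") (auto simp: continuous_map_snd_coordinate continuous_map_fst_real)
  qed (use assms in \<open>auto simp: topspace_icube PiE_def Pi_def extensional_def\<close>)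
qed

section \<open>Maps on the boundary of a cube\<close>

text \<open>
  The boundary consists of the top face and the box \<open>J\<close> formed by the other faces.  The box
  contracts within the boundary: push it down to the bottom face and shrink that face to the corner
  \<open>z0\<close>.  By homotopy extension \<open>f\<close> is homotopic to a map \<open>f'\<close> that is constant on \<open>J\<close>, and such a
  map is a spheroid on the top face.  A null-homotopy of this spheroid, read downwards from the top
  face, extends \<open>f'\<close> over the cube.  For \<open>m = 0\<close> the spheroids are points and the hypothesis is path
  connectedness.
\<close>

lemma boundary_map_extends_over_cube:
  assumes Z: "finite_t0_space Z"
    and null: "\<And>z a. z \<in> topspace Z \<Longrightarrow> a \<in> spheroids m Z z \<Longrightarrow> homotopic_spheroids m Z z a (\<lambda>_. z)"
    and f: "continuous_map (subtopology (cube (Suc m)) (cube_boundary (Suc m))) Z f"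
  shows "has_extension (cube (Suc m)) (cube_boundary (Suc m)) Z f"
proof -
  define I where "I = {..<Suc m}"
  define C where "C = icube I"
  define B where "B = faces I I"
  define J where "J = {s \<in> topspace C. s m = 0 \<or> (\<exists>i<m. s i = 0 \<or> s i = 1)}"
  have mI: "m \<in> I" by (simp add: I_def)
  have I_minus: "I - {m} = {..<m}" by (auto simp: I_def)
  have CB: "cube (Suc m) = C" "cube_boundary (Suc m) = B"
    by (simp_all add: cube_eq_icube cube_boundary_eq_faces C_def B_def I_def)
  have f: "continuous_map (subtopology C B) Z f" using f by (simp add: CB)
  have topC: "topspace C = I \<rightarrow>\<^sub>E {0..1}" by (simp add: C_def topspace_icube)
  have BC: "B \<subseteq> topspace C" by (simp add: B_def C_def faces_subset)
  have B_cases: "s \<in> J \<or> s m = 1" if "s \<in> B" for s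
    using that by (auto simp: B_def J_def faces_def C_def I_def less_Suc_eq)
  have JB: "J \<subseteq> B" using BC by (auto simp: B_def J_def faces_def C_def I_def less_Suc_eq)
  have clB: "closedin C B" unfolding B_def C_def by (rule closedin_faces) (auto simp: I_def)
  have clJ: "closedin C J"
  proof -
    have "J = {s \<in> topspace C. s m \<in> {0}} \<union> faces I {..<m}"
      by (auto simp: J_def faces_def C_def)
    then show ?thesis
      using closedin_icube_coordinate[OF mI, of "{0}"] closedin_faces[of "{..<m}" I]
      by (auto simp: C_def I_def)
  qed
  have metC: "metrizable_space C" by (simp add: C_def metrizable_icube)
  have metB: "metrizable_space (subtopology C B)"
    using metC by (rule metrizable_space_subtopology)
  have clJB: "closedin (subtopology C B) J" using clJ JB by (rule closedin_subset_topspace)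
  have subJ: "subtopology (subtopology C B) J = subtopology C J"
    using JB by (simp add: subtopology_subtopology Int_absorb1)
  let ?IJ = "prod_topology unit_interval (subtopology C J)"
  define z0 where "z0 = (\<lambda>i\<in>I. 0::real)"
  have z0: "z0 \<in> B" by (auto simp: z0_def B_def faces_def topspace_icube I_def)
  \<comment> \<open>The coordinate \<open>m\<close> is the height; the homotopy multiplies it by \<open>1 - t\<close>.\<close>
  have push: "homotopic_with (\<lambda>_. True) (subtopology C J) (subtopology C B) id (\<lambda>s. s(m := 0))"
  proof (subst homotopic_with, simp, intro exI conjI)
    let ?k = "\<lambda>x. (snd x)(m := (1 - fst x) * snd x m)"
    have mle: "(1 - t) * c \<le> 1" if "0 \<le> t" "t \<le> 1" "0 \<le> c" "c \<le> 1" for t c :: real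
      using that by (intro mult_le_one) auto
    show "continuous_map ?IJ (subtopology C B) ?k"
      unfolding continuous_map_in_subtopology
    proof
      show "continuous_map ?IJ C ?k"
        unfolding C_def
      proof (rule continuous_map_into_icube)
        fix k assume "k \<in> I"
        then show "continuous_map (prod_topology unit_interval (subtopology (icube I) J)) euclideanreal
            (\<lambda>x. ((snd x)(m := (1 - fst x) * snd x m)) k)"
          using continuous_map_real_mult[OF continuous_map_diff[OF continuous_map_const[THEN iffD2] continuous_map_fst_real] continuous_map_snd_coordinate[OF mI]]
          by (cases "k = m") (auto simp: continuous_map_snd_coordinate)
      qed (use mI mle in \<open>auto simp: topspace_icube PiE_def Pi_def extensional_def\<close>)
      show "?k \<in> topspace ?IJ \<rightarrow> B"
        using mI mle by (force simp: J_def topC B_def faces_def topspace_icube PiE_def Pi_def extensional_def I_def)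
    qed
  qed (auto simp: fun_eq_iff)
  have contract: "homotopic_with (\<lambda>_. True) (subtopology C J) (subtopology C B) (\<lambda>s. s(m := 0)) (\<lambda>_. z0)"
  proof (subst homotopic_with, simp, intro exI conjI)
    let ?k = "\<lambda>x. (\<lambda>i\<in>I. if i = m then 0 else (1 - fst x) * snd x i)"
    have mle: "(1 - t) * c \<le> 1" if "0 \<le> t" "t \<le> 1" "0 \<le> c" "c \<le> 1" for t c :: real
      using that by (intro mult_le_one) auto
    show "continuous_map ?IJ (subtopology C B) ?k"
      unfolding continuous_map_in_subtopology
    proof
      show "continuous_map ?IJ C ?k"
        unfolding C_def
      proof (rule continuous_map_into_icube)
        fix k assume "k \<in> I"
        then show "continuous_map (prod_topology unit_interval (subtopology (icube I) J)) euclideanreal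
            (\<lambda>x. (\<lambda>i\<in>I. if i = m then 0 else (1 - fst x) * snd x i) k)"
          using continuous_map_real_mult[OF continuous_map_diff[OF continuous_map_const[THEN iffD2] continuous_map_fst_real] continuous_map_snd_coordinate[of k I J]]
          by (cases "k = m") auto
      qed (use mI mle in \<open>auto simp: topspace_icube PiE_def Pi_def extensional_def\<close>)
      show "?k \<in> topspace ?IJ \<rightarrow> B"
        using mI mle by (force simp: J_def topC B_def faces_def topspace_icube PiE_def Pi_def extensional_def I_def)
    qed
  qed (use mI in \<open>auto simp: fun_eq_iff z0_def topC PiE_def extensional_def\<close>)
  define z where "z = f z0"
  have z: "z \<in> topspace Z"
    using continuous_map_image_subset_topspace[OF f] z0 BC by (auto simp: z_def)
  have "homotopic_with (\<lambda>_. True) (subtopology C J) Z (f \<circ> id) (f \<circ> (\<lambda>_. z0))"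
    by (rule homotopic_with_compose_continuous_map_left[OF homotopic_with_trans[OF push contract] f]) simp
  then obtain h where h: "continuous_map ?IJ Z h" "\<And>s. h (0, s) = f s" "\<And>s. h (1, s) = z"
    unfolding homotopic_with_def by (auto simp: z_def)
  obtain H where H: "continuous_map (prod_topology unit_interval (subtopology C B)) Z H"
    "\<And>s. s \<in> topspace (subtopology C B) \<Longrightarrow> H (0, s) = f s"
    "\<And>t s. t \<in> {0..1} \<Longrightarrow> s \<in> J \<Longrightarrow> H (t, s) = h (t, s)"
    by (rule homotopy_extension[OF metB Z clJB f]) (use h subJ in auto)
  define f' where "f' = H \<circ> Pair 1"
  have f': "continuous_map (subtopology C B) Z f'"
    unfolding f'_def by (rule continuous_map_o_Pair[OF H(1)]) simp
  have f'J: "f' s = z" if "s \<in> J" for s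
    using H(3)[of 1 s] h(3) that by (simp add: f'_def)
  have ff': "homotopic_with (\<lambda>_. True) (subtopology C B) Z f f'"
    by (subst homotopic_with) (use H in \<open>auto simp: f'_def\<close>)
  define a where "a s = f' (s(m := 1))" for s
  have top: "continuous_map (cube m) (subtopology C B) (\<lambda>s. s(m := 1))"
    unfolding continuous_map_in_subtopology
  proof
    show up: "continuous_map (cube m) C (\<lambda>s. s(m := 1))"
      using continuous_map_update_coordinate(2)[OF mI, of 1] by (simp add: C_def cube_eq_icube I_minus)
    show "(\<lambda>s. s(m := 1)) \<in> topspace (cube m) \<rightarrow> B"
      using continuous_map_funspace[OF up] mI by (force simp: B_def faces_def C_def)
  qed
  have a: "continuous_map (cube m) Z a"
    using continuous_map_compose[OF top f'] by (simp add: o_def a_def[abs_def])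
  have "a \<in> spheroids m Z z"
    unfolding spheroids_def
  proof (intro CollectI conjI ballI a)
    fix s assume s: "s \<in> cube_boundary m"
    then have "s(m := 1) \<in> B" using continuous_map_funspace[OF top] by (auto simp: cube_boundary_def)
    then have "s(m := 1) \<in> J" using s BC unfolding J_def cube_boundary_def by auto
    then show "a s = z" by (simp add: a_def f'J)
  qed
  then have "homotopic_spheroids m Z z a (\<lambda>_. z)" using null z by blast
  then obtain G where G: "continuous_map (prod_topology unit_interval (cube m)) Z G"
    "\<And>s. G (0, s) = a s" "\<And>s. G (1, s) = z" "\<And>t s. t \<in> {0..1} \<Longrightarrow> s \<in> cube_boundary m \<Longrightarrow> G (t, s) = z"
    unfolding homotopic_spheroids_def homotopic_with_def by auto
  define F where "F s = G (1 - s m, s(m := undefined))" for s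
  have "continuous_map C (prod_topology unit_interval (cube m)) (\<lambda>s. (1 - s m, s(m := undefined)))"
  proof (rule continuous_map_pairedI)
    show "continuous_map C unit_interval (\<lambda>s. 1 - s m)"
      unfolding continuous_map_in_subtopology C_def
      using continuous_map_diff[OF continuous_map_const[THEN iffD2] continuous_map_icube_coordinate[OF mI]] mI
      by (auto simp: topspace_icube)
    show "continuous_map C (cube m) (\<lambda>s. s(m := undefined))"
      using continuous_map_update_coordinate(3)[OF mI] by (simp add: C_def cube_eq_icube I_minus)
  qed
  from continuous_map_compose[OF this G(1)]
  have F: "continuous_map C Z F" by (simp add: o_def F_def[abs_def])
  have "F s = f' s" if s: "s \<in> B" for s
  proof (cases "s \<in> J")
    case True
    have "F s = z"
    proof (cases "s m = 0")
      case True
      then show ?thesis by (simp add: F_def G)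
    next
      case False
      then have "s(m := undefined) \<in> cube_boundary m"
        using \<open>s \<in> J\<close>
        by (auto simp: J_def cube_boundary_def cube_eq_icube topspace_icube topC I_def PiE_def Pi_def extensional_def)
      moreover have "s m \<in> {0..1}" using s BC mI PiE_mem unfolding topC by blast
      ultimately show ?thesis by (simp add: F_def G)
    qed
    then show ?thesis using f'J True by simp
  next
    case False
    then have "s m = 1" using B_cases s by blast
    then show ?thesis by (simp add: F_def G a_def fun_upd_idem)
  qed
  then have "has_extension C B Z f'" unfolding has_extension_def using F by blast
  then have "has_extension C B Z f"
    using has_extension_homotopic[OF metC Z clB] ff' homotopic_with_sym by blast
  then show ?thesis by (simp add: CB)
qed

text \<open>
  In degree \<open>0\<close>, where the cube is a point, this is path connectedness.
\<close>

lemma homotopically_trivial_imp_null_spheroid: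
  assumes Z: "homotopically_trivial Z" and z: "z \<in> topspace Z" and a: "a \<in> spheroids m Z z"
  shows "homotopic_spheroids m Z z a (\<lambda>_. z)"
proof (cases "m = 0")
  case False
  have const: "homotopic_spheroids m Z z (\<lambda>_. z) (\<lambda>_. z)"
    using z by (simp add: homotopic_spheroids_def)
  have "trivial_group (homotopy_group m Z z)"
    using Z z False by (simp add: homotopically_trivial_def)
  then have "spheroid_class m Z z a = spheroid_class m Z z (\<lambda>_. z)"
    using a by (auto simp: trivial_group_def homotopy_group_def)
  then show ?thesis using const by (auto simp: spheroid_class_def)
next
  case True
  \<comment> \<open>The only point of the cube of dimension \<open>0\<close>, as an extensional function.\<close>
  let ?u = "\<lambda>i::nat. undefined :: real"
  have top: "topspace (cube 0) = {?u}" by (simp add: cube_eq_icube topspace_icube)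
  have "a ?u \<in> topspace Z"
    using a True continuous_map_image_subset_topspace[of "cube 0" Z a] top by (auto simp: spheroids_def)
  then obtain g where g: "pathin Z g" "g 0 = a ?u" "g 1 = z"
    using Z z unfolding homotopically_trivial_def path_connected_space_def by blast
  have "continuous_map (prod_topology unit_interval (cube 0)) Z (g \<circ> fst)"
    using continuous_map_compose[OF continuous_map_fst g(1)[unfolded pathin_def]] .
  then show ?thesis
    unfolding homotopic_spheroids_def True
    by (subst homotopic_with)
      (use g top in \<open>auto simp: cube_boundary_def intro!: exI[of _ "g \<circ> fst"]\<close>)
qed

text \<open>
  Transfer to an arbitrary finite index set along an enumeration of its elements.
\<close>

lemma boundary_map_extends_over_icube:
  assumes Z: "finite_t0_space Z" and tr: "homotopically_trivial Z" and A: "finite A"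
    and f: "continuous_map (subtopology (icube A) (faces A A)) Z f"
  shows "has_extension (icube A) (faces A A) Z f"
proof -
  define n where "n = card A"
  let ?n = "{..<n}"
  obtain b where b: "bij_betw b ?n A"
    using ex_bij_betw_nat_finite[OF A] by (auto simp: n_def atLeast0LessThan)
  define b' where "b' = inv_into ?n b"
  have b': "b' i \<in> ?n" "b (b' i) = i" if "i \<in> A" for i
    using b that unfolding b'_def
    by (auto simp: bij_betw_def f_inv_into_f intro: inv_into_into[of _ b ?n, simplified])
  have bA: "b k \<in> A" "b' (b k) = k" if "k \<in> ?n" for k
    using b that unfolding b'_def by (auto simp: bij_betw_def)
  define c where "c s = (\<lambda>i\<in>A. s (b' i))" for s :: "nat \<Rightarrow> real"
  define d where "d s = (\<lambda>k\<in>?n. s (b k))" for s :: "nat \<Rightarrow> real"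
  have c: "continuous_map (icube ?n) (icube A) c"
    unfolding c_def
  proof (rule continuous_map_into_icube)
    show "continuous_map (icube ?n) euclideanreal (\<lambda>x. (\<lambda>i\<in>A. x (b' i)) i)" if "i \<in> A" for i
      using that b' continuous_map_icube_coordinate[of "b' i" ?n] by simp
  qed (use b' in \<open>auto simp: topspace_icube\<close>)
  have d: "continuous_map (icube A) (icube ?n) d"
    unfolding d_def
  proof (rule continuous_map_into_icube)
    show "continuous_map (icube A) euclideanreal (\<lambda>x. (\<lambda>i\<in>?n. x (b i)) i)" if "i \<in> ?n" for i
      using that bA continuous_map_icube_coordinate[of "b i" A] by simp
  qed (use bA in \<open>auto simp: topspace_icube\<close>)
  have cd: "c (d s) = s" if "s \<in> topspace (icube A)" for s
    using that b' by (fastforce simp: c_def d_def topspace_icube PiE_def extensional_def fun_eq_iff)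
  have c_faces: "c s \<in> faces A A" if "s \<in> faces ?n ?n" for s
  proof -
    have "c s \<in> topspace (icube A)" using that continuous_map_funspace[OF c] by (auto simp: faces_def)
    moreover have "\<exists>k\<in>?n. s k = 0 \<or> s k = 1" using that by (simp add: faces_def)
    then obtain k where "k \<in> ?n" "s k = 0 \<or> s k = 1" by blast
    ultimately show ?thesis using bA[of k] by (auto simp: faces_def c_def intro!: bexI[of _ "b k"])
  qed
  have d_faces: "d s \<in> faces ?n ?n" if "s \<in> faces A A" for s
  proof -
    have "d s \<in> topspace (icube ?n)" using that continuous_map_funspace[OF d] by (auto simp: faces_def)
    moreover have "\<exists>i\<in>A. s i = 0 \<or> s i = 1" using that by (simp add: faces_def)
    then obtain i where "i \<in> A" "s i = 0 \<or> s i = 1" by blast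
    ultimately show ?thesis using b'[of i] by (auto simp: faces_def d_def intro!: bexI[of _ "b' i"])
  qed
  have "continuous_map (subtopology (icube ?n) (faces ?n ?n)) (subtopology (icube A) (faces A A)) c"
    unfolding continuous_map_in_subtopology
    using c c_faces by (auto intro: continuous_map_from_subtopology)
  from continuous_map_compose[OF this f]
  have fc: "continuous_map (subtopology (icube ?n) (faces ?n ?n)) Z (f \<circ> c)" .
  have "has_extension (icube ?n) (faces ?n ?n) Z (f \<circ> c)"
  proof (cases n)
    case 0
    obtain z where "z \<in> topspace Z" using tr unfolding homotopically_trivial_def by blast
    then show ?thesis
      unfolding has_extension_def 0 by (intro exI[of _ "\<lambda>_. z"]) (auto simp: faces_def)
  next
    case (Suc m)
    show ?thesis
      using boundary_map_extends_over_cube[OF Z homotopically_trivial_imp_null_spheroid[OF tr], of m "f \<circ> c"] fc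
      by (simp add: cube_eq_icube cube_boundary_eq_faces Suc)
  qed
  then obtain F where F: "continuous_map (icube ?n) Z F" "\<And>s. s \<in> faces ?n ?n \<Longrightarrow> F s = f (c s)"
    unfolding has_extension_def by auto
  have "(F \<circ> d) s = f s" if "s \<in> faces A A" for s
    using F(2) d_faces[OF that] cd[of s] that faces_subset[of A A] by auto
  then show ?thesis
    unfolding has_extension_def using continuous_map_compose[OF d F(1)] by blast
qed

section \<open>Extension over cubes, slice by slice\<close>

lemma continuous_map_paste_closed_sets:
  assumes S: "closedin X S" and T: "closedin X T"
    and f: "continuous_map (subtopology X S) Y f" and g: "continuous_map (subtopology X T) Y g"
    and agree: "\<And>x. x \<in> S \<Longrightarrow> x \<in> T \<Longrightarrow> f x = g x"
  shows "continuous_map (subtopology X (S \<union> T)) Y (\<lambda>x. if x \<in> S then f x else g x)"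
proof (rule continuous_map_paste_closed)
  show "closedin (subtopology X (S \<union> T)) S" "closedin (subtopology X (S \<union> T)) T"
    using S T by (auto intro: closedin_subset_topspace)
qed (use f g agree in \<open>auto simp: subtopology_subtopology Int_absorb1\<close>)

text \<open>
  The values of \<open>p\<close> outside \<open>N\<close> form a compact set that does not contain \<open>c\<close>.
\<close>

lemma open_neighbourhood_of_level_contains_band:
  assumes C: "compact_space C" and p: "continuous_map C euclideanreal p" and N: "openin C N"
    and c: "\<And>s. s \<in> topspace C \<Longrightarrow> p s = c \<Longrightarrow> s \<in> N"
  obtains e where "e > 0" "\<And>s. s \<in> topspace C \<Longrightarrow> p s \<in> {c - e..c + e} \<Longrightarrow> s \<in> N"
proof -
  let ?V = "p ` (topspace C - N)"
  have "compactin C (topspace C - N)"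
    using C N by (intro closedin_compact_space closedin_diff) auto
  then have "compactin euclideanreal ?V" using p by (rule image_compactin)
  then have "closed ?V" by (simp add: compact_imp_closed)
  moreover have "c \<notin> ?V" using c by auto
  ultimately obtain e where e: "e > 0" "cball c e \<subseteq> - ?V"
    using open_contains_cball[of "- ?V"] open_Compl[of ?V] by blast
  show thesis
  proof
    show "s \<in> N" if "s \<in> topspace C" "p s \<in> {c - e..c + e}" for s
    proof (rule ccontr)
      assume "s \<notin> N"
      moreover have "p s \<in> cball c e" using that(2) by (auto simp: cball_def dist_real_def)
      ultimately show False using e(2) that(1) by blast
    qed
  qed (use e in auto)
qed

definition slab :: "nat set \<Rightarrow> nat \<Rightarrow> real \<Rightarrow> real \<Rightarrow> (nat \<Rightarrow> real) set" where
  "slab A j a b = {s \<in> topspace (icube A). s j \<in> {a..b}}"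

lemma closedin_slab: "j \<in> A \<Longrightarrow> closedin (icube A) (slab A j a b)"
  unfolding slab_def by (rule closedin_icube_coordinate) auto

text \<open>
  An extension over the slice \<open>s j = c\<close>, together with the given map on \<open>G\<close>, is a map on a closed
  set.  It extends to an open neighbourhood, which contains a whole slab around the slice.
\<close>

lemma extends_near_slice:
  assumes Z: "finite_t0_space Z" and j: "j \<in> A" and c: "c \<in> {0..1}"
    and G: "closedin (icube A) G" and f: "continuous_map (subtopology (icube A) G) Z f"
    and slice: "\<And>g. continuous_map
        (subtopology (icube (A - {j})) {s \<in> topspace (icube (A - {j})). s(j := c) \<in> G}) Z g \<Longrightarrow>
      has_extension (icube (A - {j})) {s \<in> topspace (icube (A - {j})). s(j := c) \<in> G} Z g"
  obtains e F where "e > 0" "continuous_map (subtopology (icube A) (G \<union> slab A j (c - e) (c + e))) Z F"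
    "\<And>s. s \<in> G \<Longrightarrow> F s = f s"
proof -
  let ?C = "icube A" and ?D = "icube (A - {j})"
  let ?G = "{s \<in> topspace ?D. s(j := c) \<in> G}"
  have "continuous_map (subtopology ?D ?G) (subtopology ?C G) (\<lambda>s. s(j := c))"
    unfolding continuous_map_in_subtopology
    using continuous_map_update_coordinate(2)[OF j c] by (auto intro: continuous_map_from_subtopology)
  from continuous_map_compose[OF this f]
  have "continuous_map (subtopology ?D ?G) Z (\<lambda>s. f (s(j := c)))" by (simp add: o_def)
  from slice[OF this] obtain g where g: "continuous_map ?D Z g"
    "\<And>s. s \<in> topspace ?D \<Longrightarrow> s(j := c) \<in> G \<Longrightarrow> g s = f (s(j := c))"
    unfolding has_extension_def by auto
  define F where "F s = (if s \<in> G then f s else (g \<circ> (\<lambda>s. s(j := undefined))) s)" for s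
  have F: "continuous_map (subtopology ?C (G \<union> slab A j c c)) Z F"
    unfolding F_def
  proof (rule continuous_map_paste_closed_sets[OF G closedin_slab[OF j] f])
    show "continuous_map (subtopology ?C (slab A j c c)) Z (g \<circ> (\<lambda>s. s(j := undefined)))"
      by (intro continuous_map_from_subtopology
          continuous_map_compose[OF continuous_map_update_coordinate(3)[OF j] g(1)])
    fix s assume s: "s \<in> G" "s \<in> slab A j c c"
    then have "s(j := undefined) \<in> topspace ?D"
      using continuous_map_funspace[OF continuous_map_update_coordinate(3)[OF j]] by (auto simp: slab_def)
    moreover have "s(j := undefined, j := c) = s" using s(2) by (auto simp: slab_def)
    ultimately show "f s = (g \<circ> (\<lambda>s. s(j := undefined))) s" using g(2)[of "s(j := undefined)"] s(1) by simp
  qed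
  have clGs: "closedin ?C (G \<union> slab A j c c)" using G closedin_slab[OF j] by (rule closedin_Un)
  obtain N k where N: "openin ?C N" "G \<union> slab A j c c \<subseteq> N" "continuous_map (subtopology ?C N) Z k"
    "\<And>s. s \<in> G \<union> slab A j c c \<Longrightarrow> k s = F s"
    using extends_to_open_neighbourhood[OF metrizable_icube Z clGs F] by blast
  obtain e where e: "e > 0" "\<And>s. s \<in> topspace ?C \<Longrightarrow> s j \<in> {c - e..c + e} \<Longrightarrow> s \<in> N"
    by (rule open_neighbourhood_of_level_contains_band[OF compact_icube continuous_map_icube_coordinate[OF j] N(1), of c])
      (use N(2) in \<open>auto simp: slab_def\<close>)
  show thesis
  proof
    show "continuous_map (subtopology ?C (G \<union> slab A j (c - e) (c + e))) Z k"
      by (rule continuous_map_from_subtopology_mono[OF N(3)]) (use e(2) N(2) in \<open>auto simp: slab_def\<close>)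
    show "k s = f s" if "s \<in> G" for s
      using N(4)[of s] that by (simp add: F_def)
  qed (rule e(1))
qed

text \<open>
  Extensions over two adjacent slabs need not agree on the common slice \<open>s j = c\<close>.  The two maps on
  this slice are joined by a homotopy that is constant on \<open>G\<close>; a point of the homotopy at time \<open>t\<close> is
  encoded as the point of the cube whose coordinate \<open>j\<close> is replaced by \<open>t\<close>, so that the homotopy is
  supplied by the extension hypothesis \<open>slide\<close>.  Homotopy extension then changes the map on the
  second slab, without changing it on \<open>G\<close>, into one that agrees with the first map on the slice.
\<close>

lemma extends_past_slice:
  assumes Z: "finite_t0_space Z" and j: "j \<in> A" and c: "c \<in> {0..1}" "a \<le> c" "c \<le> b"
    and G: "closedin (icube A) G"
    and F: "continuous_map (subtopology (icube A) (G \<union> slab A j a c)) Z F"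
    and F': "continuous_map (subtopology (icube A) (G \<union> slab A j c b)) Z F'"
    and agree: "\<And>s. s \<in> G \<Longrightarrow> F s = F' s"
    and slide: "\<And>g. continuous_map (subtopology (icube A)
        ({s \<in> topspace (icube A). s(j := c) \<in> G} \<union> faces A {j})) Z g \<Longrightarrow>
      has_extension (icube A) ({s \<in> topspace (icube A). s(j := c) \<in> G} \<union> faces A {j}) Z g"
  obtains H where "continuous_map (subtopology (icube A) (G \<union> slab A j a b)) Z H"
    "\<And>s. s \<in> G \<Longrightarrow> H s = F s"
proof -
  let ?C = "icube A"
  let ?p = "\<lambda>s. s(j := c)"
  \<comment> \<open>On \<open>G'\<close> the homotopy is prescribed by the values on \<open>G\<close>, at time \<open>0\<close> (\<open>lo\<close>) by \<open>F'\<close> and at time \<open>1\<close>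
    (\<open>hi\<close>) by \<open>F\<close>.\<close>
  define G' where "G' = {s \<in> topspace ?C. s(j := c) \<in> G}"
  define lo where "lo = slab A j 0 0"
  define hi where "hi = slab A j 1 1"
  define sl where "sl = slab A j c c"
  have p: "continuous_map ?C ?C ?p" using continuous_map_update_coordinate(1)[OF j c(1)] .
  have pC: "?p s \<in> topspace ?C" if "s \<in> topspace ?C" for s
    using continuous_map_funspace[OF p] that by auto
  have GC: "G \<subseteq> topspace ?C" using G by (rule closedin_subset)
  have clG': "closedin ?C G'" unfolding G'_def using closedin_continuous_map_preimage[OF p G] .
  have faces: "faces A {j} = hi \<union> lo" by (auto simp: faces_def lo_def hi_def slab_def)
  have pF: "continuous_map (subtopology ?C (G' \<union> hi)) Z (F \<circ> ?p)"
  proof (rule continuous_map_compose[OF _ F])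
    show "continuous_map (subtopology ?C (G' \<union> hi)) (subtopology ?C (G \<union> slab A j a c)) ?p"
      unfolding continuous_map_in_subtopology
      using p pC c by (auto intro: continuous_map_from_subtopology simp: slab_def)
  qed
  have pF': "continuous_map (subtopology ?C lo) Z (F' \<circ> ?p)"
  proof (rule continuous_map_compose[OF _ F'])
    show "continuous_map (subtopology ?C lo) (subtopology ?C (G \<union> slab A j c b)) ?p"
      unfolding continuous_map_in_subtopology
      using p pC c by (auto intro: continuous_map_from_subtopology simp: slab_def)
  qed
  have clhi: "closedin ?C hi" and cllo: "closedin ?C lo" and clsl: "closedin ?C sl"
    unfolding hi_def lo_def sl_def using closedin_slab[OF j] by blast+
  have "continuous_map (subtopology ?C ((G' \<union> hi) \<union> lo)) Z
          (\<lambda>s. if s \<in> G' \<union> hi then (F \<circ> ?p) s else (F' \<circ> ?p) s)"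
    by (rule continuous_map_paste_closed_sets[OF closedin_Un[OF clG' clhi] cllo pF pF'])
      (use agree in \<open>auto simp: G'_def hi_def lo_def slab_def\<close>)
  then have "has_extension ?C (G' \<union> faces A {j}) Z
          (\<lambda>s. if s \<in> G' \<union> hi then (F \<circ> ?p) s else (F' \<circ> ?p) s)"
    unfolding G'_def by (intro slide) (simp add: G'_def faces Un_assoc)
  then obtain P where P: "continuous_map ?C Z P"
    "\<And>s. s \<in> G' \<union> hi \<Longrightarrow> P s = F (s(j := c))" "\<And>s. s \<in> lo \<Longrightarrow> P s = F' (s(j := c))"
    unfolding has_extension_def faces using agree
    by (fastforce simp: G'_def hi_def lo_def slab_def)
  let ?M = "subtopology ?C (G \<union> slab A j c b)"
  let ?E = "G \<union> sl"
  have slb: "sl \<subseteq> slab A j c b" using c by (auto simp: sl_def slab_def)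
  have subE: "subtopology ?M ?E = subtopology ?C ?E"
    using slb by (simp add: subtopology_subtopology Int_absorb1 le_supI2 sup.coboundedI2)
  let ?IE = "prod_topology unit_interval (subtopology ?C ?E)"
  define h where "h x = (if x \<in> {0..1::real} \<times> G then (F \<circ> snd) x else (P \<circ> (\<lambda>x. (snd x)(j := fst x))) x)" for x
  have h: "continuous_map ?IE Z h"
    unfolding h_def
  proof (rule continuous_map_paste_closed)
    show "closedin ?IE ({0..1} \<times> G)" "closedin ?IE ({0..1} \<times> sl)"
      using G clsl by (auto simp: closedin_prod_Times_iff intro: closedin_subset_topspace)
    show "topspace ?IE \<subseteq> {0..1} \<times> G \<union> {0..1} \<times> sl" by auto
    have FG: "continuous_map (subtopology ?C G) Z F"
      by (rule continuous_map_from_subtopology_mono[OF F]) auto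
    have "subtopology ?IE ({0..1} \<times> G) = prod_topology unit_interval (subtopology ?C G)"
      by (simp only: subtopology_subtopology subtopology_Times Int_absorb) (simp add: Int_absorb1)
    then show "continuous_map (subtopology ?IE ({0..1} \<times> G)) Z (F \<circ> snd)"
      using continuous_map_compose[OF continuous_map_snd FG] by simp
    show "continuous_map (subtopology ?IE ({0..1} \<times> sl)) Z (P \<circ> (\<lambda>x. (snd x)(j := fst x)))"
      by (intro continuous_map_from_subtopology
          continuous_map_compose[OF continuous_map_update_coordinate(4)[OF j] P(1)])
    fix x :: "real \<times> (nat \<Rightarrow> real)" assume x: "x \<in> {0..1} \<times> G" "x \<in> {0..1} \<times> sl"
    then obtain t s where ts: "x = (t, s)" "t \<in> {0..1}" "s \<in> G" "s \<in> sl" by auto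
    have "s(j := t) \<in> topspace ?C"
      using ts j GC by (auto simp: topspace_icube PiE_def Pi_def extensional_def)
    moreover have s: "s(j := t, j := c) = s" using ts by (auto simp: sl_def slab_def)
    ultimately have "s(j := t) \<in> G'" using ts by (simp add: G'_def)
    then show "(F \<circ> snd) x = (P \<circ> (\<lambda>x. (snd x)(j := fst x))) x"
      using P(2)[of "s(j := t)"] s ts by simp
  qed
  have upd: "s(j := c) = s" if "s \<in> sl" for s using that by (auto simp: sl_def slab_def)
  have in_hi: "s(j := 1) \<in> hi" and in_lo: "s(j := 0) \<in> lo" if "s \<in> sl" for s
    using that j by (auto simp: sl_def hi_def lo_def slab_def topspace_icube PiE_def Pi_def extensional_def)
  have "homotopic_with (\<lambda>_. True) (subtopology ?M ?E) Z F' F"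
    unfolding subE
  proof (subst homotopic_with, simp, intro exI conjI ballI)
    show "continuous_map ?IE Z h" by (rule h)
    fix s assume "s \<in> topspace (subtopology ?C ?E)"
    then have s: "s \<in> G \<or> s \<in> sl" by auto
    show "h (0, s) = F' s"
      using s agree P(3)[OF in_lo] upd by (auto simp: h_def)
    show "h (1, s) = F s"
      using s P(2)[of "s(j := 1)"] in_hi upd by (auto simp: h_def)
  qed auto
  moreover have "has_extension ?M ?E Z F'" unfolding has_extension_def using F' by blast
  moreover have "closedin ?M ?E"
    using closedin_Un[OF G clsl] by (rule closedin_subset_topspace) (use slb in auto)
  ultimately have "has_extension ?M ?E Z F"
    using has_extension_homotopic[OF metrizable_space_subtopology[OF metrizable_icube] Z] by blast
  then obtain Q where Q: "continuous_map ?M Z Q" "\<And>s. s \<in> ?E \<Longrightarrow> Q s = F s"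
    unfolding has_extension_def by auto
  define H where "H s = (if s \<in> G \<union> slab A j a c then F s else Q s)" for s
  have "continuous_map (subtopology ?C ((G \<union> slab A j a c) \<union> (G \<union> slab A j c b))) Z H"
    unfolding H_def
    by (rule continuous_map_paste_closed_sets[OF _ _ F Q(1)])
      (use G closedin_slab[OF j] Q(2) in \<open>auto simp: sl_def slab_def\<close>)
  moreover have "(G \<union> slab A j a c) \<union> (G \<union> slab A j c b) = G \<union> slab A j a b"
    using c by (auto simp: slab_def)
  ultimately show thesis using that[of H] by (simp add: H_def)
qed

text \<open>
  Let \<open>m\<close> be the supremum of all \<open>c\<close> such that the map extends over the slab between \<open>0\<close> and \<open>c\<close>.
  An extension over a slab around \<open>s j = m\<close> can be glued to one that ends shortly before \<open>m\<close>, so the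
  supremum is \<open>1\<close> and is attained.
\<close>

lemma has_extension_slicewise:
  assumes Z: "finite_t0_space Z" and j: "j \<in> A" and G: "closedin (icube A) G"
    and f: "continuous_map (subtopology (icube A) G) Z f"
    and slice: "\<And>c g. c \<in> {0..1} \<Longrightarrow> continuous_map
        (subtopology (icube (A - {j})) {s \<in> topspace (icube (A - {j})). s(j := c) \<in> G}) Z g \<Longrightarrow>
      has_extension (icube (A - {j})) {s \<in> topspace (icube (A - {j})). s(j := c) \<in> G} Z g"
    and slide: "\<And>c g. c \<in> {0..1} \<Longrightarrow> continuous_map (subtopology (icube A)
        ({s \<in> topspace (icube A). s(j := c) \<in> G} \<union> faces A {j})) Z g \<Longrightarrow>
      has_extension (icube A) ({s \<in> topspace (icube A). s(j := c) \<in> G} \<union> faces A {j}) Z g"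
  shows "has_extension (icube A) G Z f"
proof -
  let ?C = "icube A"
  define T where "T = {c \<in> {0..1}. \<exists>F. continuous_map (subtopology ?C (G \<union> slab A j 0 c)) Z F \<and>
                          (\<forall>s\<in>G. F s = f s)}"
  have near: "\<exists>e>0. \<exists>F. continuous_map (subtopology ?C (G \<union> slab A j (c - e) (c + e))) Z F \<and>
                          (\<forall>s\<in>G. F s = f s)" if c: "c \<in> {0..1}" for c
    using extends_near_slice[OF Z j c G f slice[OF c]] by metis
  have restrict: "continuous_map (subtopology ?C (G \<union> slab A j a' b')) Z F"
    if "continuous_map (subtopology ?C (G \<union> slab A j a b)) Z F" "a \<le> a'" "b' \<le> b" for a b a' b' F
    by (rule continuous_map_from_subtopology_mono[OF that(1)]) (use that in \<open>auto simp: slab_def\<close>)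
  have 0: "0 \<in> T"
  proof -
    obtain e F where F: "e > 0" "continuous_map (subtopology ?C (G \<union> slab A j (0 - e) (0 + e))) Z F"
      "\<forall>s\<in>G. F s = f s"
      using near[of 0] by auto
    have "continuous_map (subtopology ?C (G \<union> slab A j 0 0)) Z F"
      using restrict[OF F(2), of 0 0] F(1) by simp
    then show ?thesis using F(3) unfolding T_def by auto
  qed
  have bdd: "bdd_above T" by (rule bdd_aboveI[of _ 1]) (simp add: T_def)
  define m where "m = Sup T"
  have m: "m \<in> {0..1}"
  proof -
    have "0 \<le> m" unfolding m_def using 0 bdd by (rule cSup_upper)
    moreover have "m \<le> 1" unfolding m_def
    proof (rule cSup_least)
      show "c \<le> 1" if "c \<in> T" for c using that unfolding T_def by simp
    qed (use 0 in blast)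
    ultimately show ?thesis by simp
  qed
  obtain e F' where e: "e > 0" and F': "continuous_map (subtopology ?C (G \<union> slab A j (m - e) (m + e))) Z F'"
    "\<And>s. s \<in> G \<Longrightarrow> F' s = f s"
    using near[OF m] by blast
  obtain c where c: "c \<in> T" "m - e < c"
    using less_cSupD[of T "m - e"] 0 e unfolding m_def by fastforce
  have cm: "c \<le> m" unfolding m_def using c(1) bdd by (rule cSup_upper)
  obtain F where F: "continuous_map (subtopology ?C (G \<union> slab A j 0 c)) Z F" "\<And>s. s \<in> G \<Longrightarrow> F s = f s"
    and c01: "c \<in> {0..1}"
    using c(1) unfolding T_def by blast
  have F'c: "continuous_map (subtopology ?C (G \<union> slab A j c (m + e))) Z F'"
    using restrict[OF F'(1)] c(2) by simp
  obtain H where H: "continuous_map (subtopology ?C (G \<union> slab A j 0 (m + e))) Z H"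
    "\<And>s. s \<in> G \<Longrightarrow> H s = F s"
    by (rule extends_past_slice[OF Z j c01 _ _ G F(1) F'c _ slide[OF c01]])
      (use c01 cm e F(2) F'(2) in auto)
  have "continuous_map (subtopology ?C (G \<union> slab A j 0 (min 1 (m + e)))) Z H"
    using restrict[OF H(1)] by simp
  then have "min 1 (m + e) \<in> T"
    using H(2) F(2) m e unfolding T_def by auto
  moreover from this have "min 1 (m + e) \<le> m" unfolding m_def using bdd by (rule cSup_upper)
  ultimately have "1 \<in> T" using e by (auto simp: min_def split: if_splits)
  then obtain K where K: "continuous_map (subtopology ?C (G \<union> slab A j 0 1)) Z K" "\<And>s. s \<in> G \<Longrightarrow> K s = f s"
    unfolding T_def by auto
  have "topspace ?C \<subseteq> G \<union> slab A j 0 1" using j by (auto simp: slab_def topspace_icube)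
  then have "continuous_map ?C Z K" using K(1) by (metis subtopology_superset)
  then show ?thesis unfolding has_extension_def using K(2) by blast
qed

text \<open>
  The coordinates in \<open>K\<close> are the times of iterated homotopies: the map is prescribed on the faces
  orthogonal to them and on a closed set \<open>E\<close> whose membership does not depend on them, as for a
  homotopy that is prescribed on a set of points at all times.  Sweeping along a coordinate \<open>j\<close>
  outside \<open>K\<close> leads to a slice problem, which lacks \<open>j\<close>, and to a sliding problem, in which \<open>j\<close> belongs
  to \<open>K\<close>; both have fewer coordinates outside \<open>K\<close>.  If \<open>K\<close> contains all coordinates, then \<open>E\<close> is empty
  or the whole cube, and only the extension from the boundary is left.
\<close>

lemma saturated_map_extends_over_icube:
  assumes Z: "finite_t0_space Z" and tr: "homotopically_trivial Z"
  shows "finite A \<Longrightarrow> K \<subseteq> A \<Longrightarrow> closedin (icube A) E \<Longrightarrow>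
    (\<And>s t. s \<in> E \<Longrightarrow> t \<in> topspace (icube A) \<Longrightarrow> (\<And>i. i \<in> A - K \<Longrightarrow> t i = s i) \<Longrightarrow> t \<in> E) \<Longrightarrow>
    continuous_map (subtopology (icube A) (E \<union> faces A K)) Z f \<Longrightarrow>
    has_extension (icube A) (E \<union> faces A K) Z f"
proof (induction "card (A - K)" arbitrary: A K E f)
  case 0
  then have K: "K = A" by auto
  show ?case
  proof (cases "E = {}")
    case True
    then show ?thesis using boundary_map_extends_over_icube[OF Z tr \<open>finite A\<close>] 0 K by simp
  next
    case False
    then have "topspace (icube A) \<subseteq> E" using "0.prems"(4) K by blast
    then have "subtopology (icube A) (E \<union> faces A K) = icube A"
      by (intro subtopology_superset) auto
    then show ?thesis using "0.prems"(5) unfolding has_extension_def by auto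
  qed
next
  case (Suc n)
  note fin = Suc.prems(1) and KA = Suc.prems(2) and E = Suc.prems(3) and sat = Suc.prems(4) and f = Suc.prems(5)
  obtain j where j: "j \<in> A" "j \<notin> K" using Suc.hyps(2) by (metis DiffE card_gt_0_iff ex_in_conv zero_less_Suc)
  let ?G = "E \<union> faces A K"
  have G: "closedin (icube A) ?G"
    using E closedin_faces[OF finite_subset[OF KA fin] KA] by (rule closedin_Un)
  have EA: "E \<subseteq> topspace (icube A)" using E by (rule closedin_subset)
  show ?case
  proof (rule has_extension_slicewise[OF Z j(1) G f])
    fix c :: real and g
    assume c: "c \<in> {0..1}"
    let ?D = "icube (A - {j})"
    have up: "s(j := c) \<in> topspace (icube A)" if "s \<in> topspace ?D" for s
      using that j c by (auto simp: topspace_icube PiE_def Pi_def extensional_def)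
    let ?E = "{s \<in> topspace ?D. s(j := c) \<in> E}"
    have upK: "(\<exists>i\<in>K. (s(j := c)) i = 0 \<or> (s(j := c)) i = 1) \<longleftrightarrow> (\<exists>i\<in>K. s i = 0 \<or> s i = 1)" for s
      using j(2) by (intro bex_cong refl) auto
    have eq: "{s \<in> topspace ?D. s(j := c) \<in> ?G} = ?E \<union> faces (A - {j}) K"
      using up upK unfolding faces_def by blast
    assume "continuous_map (subtopology ?D {s \<in> topspace ?D. s(j := c) \<in> ?G}) Z g"
    then have g: "continuous_map (subtopology ?D (?E \<union> faces (A - {j}) K)) Z g" by (simp only: eq)
    have "n = card (A - {j} - K)" using Suc.hyps(2) fin j
      by (metis DiffI Diff_insert Diff_insert2 card_Diff_singleton diff_Suc_1)
    moreover have "closedin ?D ?E"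
      by (rule closedin_continuous_map_preimage[OF continuous_map_update_coordinate(2)[OF j(1) c] E])
    moreover have "t \<in> ?E" if st: "s \<in> ?E" "t \<in> topspace ?D" "\<And>i. i \<in> A - {j} - K \<Longrightarrow> t i = s i" for s t
      using sat[of "s(j := c)" "t(j := c)"] st up by auto
    ultimately have "has_extension ?D (?E \<union> faces (A - {j}) K) Z g"
      using Suc.hyps(1)[of "A - {j}" K ?E g] fin KA j g by blast
    then show "has_extension ?D {s \<in> topspace ?D. s(j := c) \<in> ?G} Z g" by (simp only: eq)
  next
    fix c :: real and g
    assume c: "c \<in> {0..1}"
    let ?C = "icube A"
    have up: "s(j := c) \<in> topspace ?C" if "s \<in> topspace ?C" for s
      using that j c by (auto simp: topspace_icube PiE_def Pi_def extensional_def)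
    let ?E = "{s \<in> topspace ?C. s(j := c) \<in> E}"
    have upK: "(\<exists>i\<in>K. (s(j := c)) i = 0 \<or> (s(j := c)) i = 1) \<longleftrightarrow> (\<exists>i\<in>K. s i = 0 \<or> s i = 1)" for s
      using j(2) by (intro bex_cong refl) auto
    have eq: "{s \<in> topspace ?C. s(j := c) \<in> ?G} \<union> faces A {j} = ?E \<union> faces A (insert j K)"
      using up upK unfolding faces_def by blast
    assume "continuous_map (subtopology ?C ({s \<in> topspace ?C. s(j := c) \<in> ?G} \<union> faces A {j})) Z g"
    then have g: "continuous_map (subtopology ?C (?E \<union> faces A (insert j K))) Z g" by (simp only: eq)
    have "n = card (A - insert j K)" using Suc.hyps(2) fin j
      by (metis DiffI Diff_insert card_Diff_singleton diff_Suc_1)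
    moreover have "closedin ?C ?E"
      by (rule closedin_continuous_map_preimage[OF continuous_map_update_coordinate(1)[OF j(1) c] E])
    moreover have "t \<in> ?E" if st: "s \<in> ?E" "t \<in> topspace ?C" "\<And>i. i \<in> A - insert j K \<Longrightarrow> t i = s i" for s t
      using sat[of "s(j := c)" "t(j := c)"] st up by auto
    ultimately have "has_extension ?C (?E \<union> faces A (insert j K)) Z g"
      using Suc.hyps(1)[of A "insert j K" ?E g] fin KA j g by blast
    then show "has_extension ?C ({s \<in> topspace ?C. s(j := c) \<in> ?G} \<union> faces A {j}) Z g" by (simp only: eq)
  qed
qed

definition absolute_extensor_for :: "'m topology \<Rightarrow> 'z topology \<Rightarrow> bool" where
  "absolute_extensor_for M Z \<longleftrightarrow>
     (\<forall>E f. closedin M E \<longrightarrow> continuous_map (subtopology M E) Z f \<longrightarrow> has_extension M E Z f)"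

lemma homotopically_trivial_imp_absolute_extensor:
  assumes "finite_t0_space Z" "homotopically_trivial Z"
  shows "absolute_extensor_for (cube n) Z"
  unfolding absolute_extensor_for_def cube_eq_icube
proof (intro allI impI)
  fix E f assume E: "closedin (icube {..<n}) E" and f: "continuous_map (subtopology (icube {..<n}) E) Z f"
  have EC: "E \<subseteq> topspace (icube {..<n})" using E by (rule closedin_subset)
  have "t = s" if "s \<in> E" "t \<in> topspace (icube {..<n})" "\<And>i. i \<in> {..<n} - {} \<Longrightarrow> t i = s i" for s t
  proof
    fix i
    have "s \<in> {..<n} \<rightarrow>\<^sub>E {0..1}" "t \<in> {..<n} \<rightarrow>\<^sub>E {0..1}"
      using that(1,2) EC by (auto simp only: topspace_icube)
    then have "i \<notin> {..<n} \<Longrightarrow> t i = s i" by (metis PiE_arb)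
    then show "t i = s i" using that(3)[of i] by blast
  qed
  then have "has_extension (icube {..<n}) (E \<union> faces {..<n} {}) Z f"
  proof (intro saturated_map_extends_over_icube[OF assms])
    show "continuous_map (subtopology (icube {..<n}) (E \<union> faces {..<n} {})) Z f"
      using f by (simp add: faces_def)
  qed (use E in auto)
  then show "has_extension (icube {..<n}) E Z f" by (simp add: faces_def)
qed

section \<open>Absolute extensors are homotopically trivial\<close>

lemma spheroid_concat_spheroid:
  assumes n: "n \<ge> 1" and f: "f \<in> spheroids n Z z" and g: "g \<in> spheroids n Z z"
  shows "spheroid_concat f g \<in> spheroids n Z z"
proof -
  let ?A = "{..<n}"
  let ?C = "icube ?A"
  have n0: "0 \<in> ?A" using n by auto
  have fg: "continuous_map ?C Z f" "continuous_map ?C Z g"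
    "\<And>s. s \<in> faces ?A ?A \<Longrightarrow> f s = z" "\<And>s. s \<in> faces ?A ?A \<Longrightarrow> g s = z"
    using f g unfolding spheroids_def cube_eq_icube cube_boundary_eq_faces by auto
  define S where "S = {s \<in> topspace ?C. s 0 \<in> {..1/2}}"
  define T where "T = {s \<in> topspace ?C. s 0 \<in> {1/2..}}"
  define p where "p s = s(0 := 2 * s 0)" for s :: "nat \<Rightarrow> real"
  define q where "q s = s(0 := 2 * s 0 - 1)" for s :: "nat \<Rightarrow> real"
  have clS: "closedin ?C S" and clT: "closedin ?C T"
    unfolding S_def T_def using closedin_icube_coordinate[OF n0] by blast+
  have pS: "p s \<in> topspace ?C" if "s \<in> S" for s
    using that n0 by (auto simp: S_def p_def topspace_icube PiE_def Pi_def extensional_def)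
  have qT: "q s \<in> topspace ?C" if "s \<in> T" for s
    using that n0 by (auto simp: T_def q_def topspace_icube PiE_def Pi_def extensional_def)
  have coord: "continuous_map (subtopology ?C U) euclideanreal (\<lambda>s. s i)" if "i \<in> ?A" for i U
    by (rule continuous_map_from_subtopology[OF continuous_map_icube_coordinate[OF that]])
  have p: "continuous_map (subtopology ?C S) ?C p"
  proof (rule continuous_map_into_icube)
    show "continuous_map (subtopology ?C S) euclideanreal (\<lambda>x. p x i)" if "i \<in> ?A" for i
      using coord[OF that] continuous_map_real_mult[OF continuous_map_const[THEN iffD2] coord[OF n0]]
      by (cases "i = 0") (auto simp: p_def)
  qed (use pS in \<open>simp add: topspace_icube\<close>)
  have q: "continuous_map (subtopology ?C T) ?C q"
  proof (rule continuous_map_into_icube)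
    show "continuous_map (subtopology ?C T) euclideanreal (\<lambda>x. q x i)" if "i \<in> ?A" for i
      using coord[OF that] continuous_map_diff[OF continuous_map_real_mult[OF
          continuous_map_const[THEN iffD2] coord[OF n0]] continuous_map_const[THEN iffD2]]
      by (cases "i = 0") (auto simp: q_def)
  qed (use qT in \<open>simp add: topspace_icube\<close>)
  have "continuous_map ?C Z (\<lambda>s. if s \<in> S then (f \<circ> p) s else (g \<circ> q) s)"
  proof (rule continuous_map_paste_closed[OF clS clT])
    show "topspace ?C \<subseteq> S \<union> T" by (auto simp: S_def T_def)
    show "continuous_map (subtopology ?C S) Z (f \<circ> p)" "continuous_map (subtopology ?C T) Z (g \<circ> q)"
      using continuous_map_compose[OF p fg(1)] continuous_map_compose[OF q fg(2)] by auto
    fix s assume s: "s \<in> S" "s \<in> T"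
    then have "s 0 = 1/2" by (auto simp: S_def T_def)
    then have "p s \<in> faces ?A ?A" "q s \<in> faces ?A ?A"
      using pS[OF s(1)] qT[OF s(2)] n0 unfolding faces_def
      by (auto simp: p_def q_def intro!: bexI[of _ 0])
    then show "(f \<circ> p) s = (g \<circ> q) s" using fg by simp
  qed
  then have "continuous_map ?C Z (spheroid_concat f g)"
    by (rule continuous_map_eq) (auto simp: spheroid_concat_def S_def p_def q_def)
  moreover have "spheroid_concat f g s = z" if s: "s \<in> faces ?A ?A" for s
  proof -
    have sC: "s \<in> topspace ?C" using s by (auto simp: faces_def)
    have "\<exists>i\<in>?A. s i = 0 \<or> s i = 1" using s by (simp add: faces_def)
    then obtain i where i: "i \<in> ?A" "s i = 0 \<or> s i = 1" by blast
    show ?thesis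
    proof (cases "s 0 \<le> 1/2")
      case True
      then have "p s \<in> topspace ?C" using pS sC by (simp add: S_def)
      moreover have "p s i = 0 \<or> p s i = 1" using i True by (cases "i = 0") (auto simp: p_def)
      ultimately have "p s \<in> faces ?A ?A" using i(1) unfolding faces_def by blast
      then show ?thesis using fg(3) True by (simp add: spheroid_concat_def p_def)
    next
      case False
      then have "q s \<in> topspace ?C" using qT sC by (simp add: T_def)
      moreover have "q s i = 0 \<or> q s i = 1" using i False by (cases "i = 0") (auto simp: q_def)
      ultimately have "q s \<in> faces ?A ?A" using i(1) unfolding faces_def by blast
      then show ?thesis using fg(4) False by (simp add: spheroid_concat_def q_def)
    qed
  qed
  ultimately show ?thesis
    unfolding spheroids_def cube_eq_icube cube_boundary_eq_faces by blast
qed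

text \<open>
  If all spheroids are null-homotopic, the carrier is a single class.  The group axioms then reduce to
  the closure of spheroids under concatenation.
\<close>

lemma trivial_homotopy_groupI:
  assumes n: "n \<ge> 1" and z: "z \<in> topspace Z"
    and null: "\<And>f. f \<in> spheroids n Z z \<Longrightarrow> homotopic_spheroids n Z z f (\<lambda>_. z)"
  shows "trivial_group (homotopy_group n Z z)"
proof -
  define c where "c = spheroid_class n Z z (\<lambda>_. z)"
  have const: "(\<lambda>_. z) \<in> spheroids n Z z" using z by (simp add: spheroids_def)
  have all_c: "spheroid_class n Z z f = c" if "f \<in> spheroids n Z z" for f
    using null[OF that] homotopic_with_trans homotopic_with_symD
    unfolding spheroid_class_def c_def homotopic_spheroids_def by blast
  have c_sph: "f \<in> spheroids n Z z" if "f \<in> c" for f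
    using that homotopic_with_imp_continuous_maps homotopic_with_imp_property
    unfolding c_def spheroid_class_def homotopic_spheroids_def spheroids_def by blast
  have c_const: "(\<lambda>_. z) \<in> c"
    using null[OF const] by (simp add: c_def spheroid_class_def)
  let ?G = "homotopy_group n Z z"
  have carr: "carrier ?G = {c}"
    using all_c const by (auto simp: homotopy_group_def)
  have one: "\<one>\<^bsub>?G\<^esub> = c" by (simp add: homotopy_group_def c_def)
  have "c \<otimes>\<^bsub>?G\<^esub> c = (\<Union>f\<in>c. \<Union>g\<in>c. c)"
    using all_c[OF spheroid_concat_spheroid[OF n c_sph c_sph]] by (simp add: homotopy_group_def)
  then have mult: "c \<otimes>\<^bsub>?G\<^esub> c = c" using c_const by auto
  have "group ?G" by (rule groupI) (auto simp: carr one mult)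
  then show ?thesis by (simp add: trivial_group_def carr one)
qed

text \<open>
  Extending from the empty subset of a point gives a point of the space, extending from the two ends
  of an interval gives a path, and extending a map on the boundary of \<open>cube (Suc n)\<close> that is a given
  spheroid on the bottom face and constant on the other faces gives a null-homotopy of the spheroid.
\<close>

lemma absolute_extensor_imp_homotopically_trivial:
  assumes ae: "\<And>n. absolute_extensor_for (cube n) Z"
  shows "homotopically_trivial Z"
  unfolding homotopically_trivial_def
proof (intro conjI ballI allI impI)
  have "has_extension (cube 0) {} Z f" for f
    using ae[of 0] unfolding absolute_extensor_for_def by (simp add: continuous_map_def)
  then obtain F where "continuous_map (cube 0) Z F" unfolding has_extension_def by blast
  then have "F (\<lambda>_. undefined) \<in> topspace Z"
    using continuous_map_funspace[of "cube 0" Z F] by (simp add: cube_eq_icube topspace_icube)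
  then show "topspace Z \<noteq> {}" by blast
next
  show "path_connected_space Z"
    unfolding path_connected_space_def
  proof (intro ballI)
    fix x y assume xy: "x \<in> topspace Z" "y \<in> topspace Z"
    let ?C = "icube {..<1}"
    define S where "S = {s \<in> topspace ?C. s 0 \<in> {0}}"
    define T where "T = {s \<in> topspace ?C. s 0 \<in> {1}}"
    have cl: "closedin ?C S" "closedin ?C T"
      unfolding S_def T_def by (rule closedin_icube_coordinate; simp)+
    have "continuous_map (subtopology ?C (S \<union> T)) Z (\<lambda>s. if s \<in> S then (\<lambda>_. x) s else (\<lambda>_. y) s)"
      by (rule continuous_map_paste_closed_sets[OF cl]) (use xy in \<open>auto simp: S_def T_def\<close>)
    then have "has_extension ?C (S \<union> T) Z (\<lambda>s. if s \<in> S then x else y)"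
      using ae[of 1] closedin_Un[OF cl] unfolding absolute_extensor_for_def cube_eq_icube by simp
    then obtain F where F: "continuous_map ?C Z F" "\<And>s. s \<in> S \<union> T \<Longrightarrow> F s = (if s \<in> S then x else y)"
      unfolding has_extension_def by auto
    define l where "l t = (\<lambda>i\<in>{..<1::nat}. t)" for t :: real
    have "continuous_map unit_interval ?C l"
      unfolding l_def by (rule continuous_map_into_icube) (auto simp: continuous_map_from_subtopology)
    from continuous_map_compose[OF this F(1)]
    have "pathin Z (F \<circ> l)" by (simp add: pathin_def)
    moreover have "l 0 \<in> S" "l 1 \<in> T" "l 1 \<notin> S" by (auto simp: l_def S_def T_def topspace_icube)
    then have "(F \<circ> l) 0 = x" "(F \<circ> l) 1 = y" using F(2) by auto
    ultimately show "\<exists>g. pathin Z g \<and> g 0 = x \<and> g 1 = y" by blast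
  qed
next
  fix z and n :: nat
  assume z: "z \<in> topspace Z" and n: "1 \<le> n"
  show "trivial_group (homotopy_group n Z z)"
  proof (rule trivial_homotopy_groupI[OF n z])
    fix f assume "f \<in> spheroids n Z z"
    then have f: "continuous_map (cube n) Z f" "\<And>s. s \<in> cube_boundary n \<Longrightarrow> f s = z"
      by (auto simp: spheroids_def)
    let ?A = "{..<Suc n}"
    let ?C = "icube ?A"
    have nA: "n \<in> ?A" "?A - {n} = {..<n}" by auto
    define S where "S = {s \<in> topspace ?C. s n \<in> {0}}"
    define T where "T = {s \<in> topspace ?C. s n \<in> {1}} \<union> faces ?A {..<n}"
    have clS: "closedin ?C S" unfolding S_def by (rule closedin_icube_coordinate) auto
    have clT: "closedin ?C T" unfolding T_def
      by (intro closedin_Un closedin_icube_coordinate closedin_faces) auto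
    have drop: "continuous_map ?C (cube n) (\<lambda>s. s(n := undefined))"
      using continuous_map_update_coordinate(3)[OF nA(1)] by (simp add: nA(2) cube_eq_icube)
    define g where "g s = (if s \<in> S then (f \<circ> (\<lambda>s. s(n := undefined))) s else (\<lambda>_. z) s)" for s
    have "continuous_map (subtopology ?C (S \<union> T)) Z g"
      unfolding g_def
    proof (rule continuous_map_paste_closed_sets[OF clS clT])
      show "continuous_map (subtopology ?C S) Z (f \<circ> (\<lambda>s. s(n := undefined)))"
        by (intro continuous_map_from_subtopology continuous_map_compose[OF drop f(1)])
      fix s assume s: "s \<in> S" "s \<in> T"
      have "s(n := undefined) \<in> topspace (cube n)"
        using s(1) continuous_map_funspace[OF drop] by (auto simp: S_def)
      moreover have "\<exists>i<n. s i = 0 \<or> s i = 1" using s by (auto simp: S_def T_def faces_def)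
      then have "\<exists>i<n. (s(n := undefined)) i = 0 \<or> (s(n := undefined)) i = 1" by auto
      ultimately have "s(n := undefined) \<in> cube_boundary n" unfolding cube_boundary_def by blast
      then show "(f \<circ> (\<lambda>s. s(n := undefined))) s = (\<lambda>_. z) s" using f(2) by simp
    qed (use z in simp)
    then have "has_extension ?C (S \<union> T) Z g"
      using ae[of "Suc n"] closedin_Un[OF clS clT] unfolding absolute_extensor_for_def cube_eq_icube by blast
    then obtain F where F: "continuous_map ?C Z F" "\<And>s. s \<in> S \<union> T \<Longrightarrow> F s = g s"
      unfolding has_extension_def by auto
    have up: "continuous_map (prod_topology unit_interval (cube n)) ?C (\<lambda>x. (snd x)(n := fst x))"
    proof (rule continuous_map_into_icube)
      show "continuous_map (prod_topology unit_interval (cube n)) euclideanreal (\<lambda>x. ((snd x)(n := fst x)) k)"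
        if "k \<in> ?A" for k
        using that continuous_map_snd_coordinate[of k "{..<n}" UNIV] continuous_map_fst_real
        by (cases "k = n") (auto simp: cube_eq_icube)
    qed (auto simp: cube_eq_icube topspace_icube PiE_def Pi_def extensional_def)
    have upC: "s(n := t) \<in> topspace ?C" if "s \<in> topspace (cube n)" "t \<in> {0..1}" for s t
      using continuous_map_funspace[OF up] that by (auto simp: Pi_def)
    show "homotopic_spheroids n Z z f (\<lambda>_. z)"
      unfolding homotopic_spheroids_def
    proof (subst homotopic_with, fastforce simp: cube_boundary_def, intro exI conjI ballI)
      show "continuous_map (prod_topology unit_interval (cube n)) Z (F \<circ> (\<lambda>x. (snd x)(n := fst x)))"
        by (rule continuous_map_compose[OF up F(1)])
    next
      fix s assume s: "s \<in> topspace (cube n)"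
      have "s(n := 0) \<in> S" using upC[OF s, of 0] by (simp add: S_def)
      moreover have "s(n := undefined) = s"
        using s by (auto simp: cube_eq_icube topspace_icube PiE_def extensional_def)
      ultimately show "(F \<circ> (\<lambda>x. (snd x)(n := fst x))) (0, s) = f s"
        using F(2) by (simp add: g_def)
      have "s(n := 1) \<in> T" "s(n := 1) \<notin> S" using upC[OF s, of 1] by (auto simp: S_def T_def)
      then show "(F \<circ> (\<lambda>x. (snd x)(n := fst x))) (1, s) = z"
        using F(2) by (simp add: g_def)
    next
      fix t :: real and s assume t: "t \<in> {0..1}" and s: "s \<in> cube_boundary n"
      then have sC: "s \<in> topspace (cube n)" by (simp add: cube_boundary_def)
      have "\<exists>i<n. s i = 0 \<or> s i = 1" using s by (simp add: cube_boundary_def)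
      then have "s(n := t) \<in> T" using upC[OF sC t] by (auto simp: T_def faces_def)
      moreover have "s(n := undefined) = s"
        using sC by (auto simp: cube_eq_icube topspace_icube PiE_def extensional_def)
      ultimately show "(F \<circ> (\<lambda>x. (snd x)(n := fst x))) (t, s) = z"
        using F(2) f(2)[OF s] by (simp add: g_def)
    qed
  qed
qed

section \<open>Joins as absolute extensors\<close>

lemma finite_topspace_nh_join:
  "finite (topspace X) \<Longrightarrow> finite (topspace Y) \<Longrightarrow> finite (topspace (nh_join X Y))"
  by (simp add: topspace_nh_join)

lemma finite_t0_spaceI:
  assumes fin: "finite (topspace Z)"
    and anti: "\<And>p q. space_le Z p q \<Longrightarrow> space_le Z q p \<Longrightarrow> p = q"
  shows "finite_t0_space Z"
  unfolding finite_t0_space_def t0_space_def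
proof (intro conjI fin ballI impI)
  fix p q assume pq: "p \<in> topspace Z" "q \<in> topspace Z" "p \<noteq> q"
  have mem: "a \<in> min_open Z b \<longleftrightarrow> space_le Z a b" if "b \<in> topspace Z" for a b
    using that by (simp add: space_le_def)
  have "p \<in> min_open Z p" "q \<in> min_open Z q" using mem pq space_le_refl by metis+
  moreover have "p \<notin> min_open Z q \<or> q \<notin> min_open Z p" using anti pq mem by metis
  ultimately show "\<exists>U. openin Z U \<and> (p \<notin> U \<longleftrightarrow> q \<in> U)"
    using openin_min_open[OF fin] pq by metis
qed

lemma finite_t0_space_nh_join:
  assumes X: "finite_t0_space X" and Y: "finite_t0_space Y"
  shows "finite_t0_space (nh_join X Y)"
proof (rule finite_t0_spaceI)
  show "finite (topspace (nh_join X Y))"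
    using X Y by (simp add: finite_topspace_nh_join finite_space_finite)
  show "p = q" if "space_le (nh_join X Y) p q" "space_le (nh_join X Y) q p" for p q
    using that space_le_antisym[OF X] space_le_antisym[OF Y]
    unfolding space_le_nh_join by (cases p; cases q) auto
qed

lemma openin_below:
  assumes fin: "finite (topspace Z)" and N: "openin M N"
    and f: "continuous_map (subtopology M N) Z f" and q: "q \<in> topspace Z"
  shows "openin M {s \<in> N. space_le Z (f s) q}"
proof (rule openin_trans_full[OF _ N])
  have "{s \<in> N. space_le Z (f s) q} = {s \<in> topspace (subtopology M N). space_le Z (f s) q}"
    using openin_subset[OF N] by auto
  then show "openin (subtopology M N) {s \<in> N. space_le Z (f s) q}"
    using f q unfolding continuous_map_into_finite_space[OF fin] by metis
qed

lemma continuous_map_into_nh_joinI: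
  assumes "finite (topspace X)" "finite (topspace Y)"
    and "\<And>s. s \<in> topspace M \<Longrightarrow> f s \<in> topspace X <+> topspace Y"
    and "\<And>x. x \<in> topspace X \<Longrightarrow> openin M {s \<in> topspace M. join_le X Y (f s) (Inl x)}"
    and "\<And>y. y \<in> topspace Y \<Longrightarrow> openin M {s \<in> topspace M. join_le X Y (f s) (Inr y)}"
  shows "continuous_map M (nh_join X Y) f"
  unfolding continuous_map_into_finite_space[OF finite_topspace_nh_join[OF assms(1,2)]]
    topspace_nh_join space_le_nh_join
  using assms(3-5) by blast

lemma continuous_map_projr:
  assumes fin: "finite (topspace X)" "finite (topspace Y)"
    and f: "continuous_map M (nh_join X Y) f"
    and img: "\<And>s. s \<in> topspace M \<Longrightarrow> f s \<in> Inr ` topspace Y"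
  shows "continuous_map M Y (\<lambda>s. projr (f s))"
  unfolding continuous_map_into_finite_space[OF fin(2)]
proof (intro conjI ballI)
  show "(\<lambda>s. projr (f s)) \<in> topspace M \<rightarrow> topspace Y" using img by fastforce
  fix y assume y: "y \<in> topspace Y"
  have "openin M {s \<in> topspace M. join_le X Y (f s) (Inr y)}"
    using f y unfolding continuous_map_into_finite_space[OF finite_topspace_nh_join[OF fin]]
      topspace_nh_join space_le_nh_join by blast
  moreover have "{s \<in> topspace M. join_le X Y (f s) (Inr y)} = {s \<in> topspace M. space_le Y (projr (f s)) y}"
    using img by fastforce
  ultimately show "openin M {s \<in> topspace M. space_le Y (projr (f s)) y}" by simp
qed

lemma continuous_map_projl:
  assumes fin: "finite (topspace X)" "finite (topspace Y)"
    and f: "continuous_map M (nh_join X Y) f"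
    and img: "\<And>s. s \<in> topspace M \<Longrightarrow> f s \<in> Inl ` topspace X"
  shows "continuous_map M X (\<lambda>s. projl (f s))"
  unfolding continuous_map_into_finite_space[OF fin(1)]
proof (intro conjI ballI)
  show "(\<lambda>s. projl (f s)) \<in> topspace M \<rightarrow> topspace X" using img by fastforce
  fix x assume x: "x \<in> topspace X"
  have "openin M {s \<in> topspace M. join_le X Y (f s) (Inl x)}"
    using f x unfolding continuous_map_into_finite_space[OF finite_topspace_nh_join[OF fin]]
      topspace_nh_join space_le_nh_join by blast
  moreover have "{s \<in> topspace M. join_le X Y (f s) (Inl x)} = {s \<in> topspace M. space_le X (projl (f s)) x}"
    using img by fastforce
  ultimately show "openin M {s \<in> topspace M. space_le X (projl (f s)) x}" by simp
qed

lemma closedin_nh_join_right: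
  "closedin (nh_join X Y) (Inr ` topspace Y)"
proof -
  have "join_open X Y (Inl ` topspace X)"
    unfolding join_open_def
  proof (intro conjI ballI allI impI)
    fix q p assume "q \<in> Inl ` topspace X" "join_le X Y p q"
    then show "p \<in> Inl ` topspace X" by (cases p) (auto simp: inj_image_mem_iff dest: space_le_in_topspace)
  qed auto
  moreover have "(topspace X <+> topspace Y) - Inr ` topspace Y = Inl ` topspace X" by auto
  ultimately show ?thesis by (auto simp: closedin_def openin_nh_join topspace_nh_join)
qed

lemma closedin_preimage_right:
  assumes K: "closedin M K" and f: "continuous_map (subtopology M K) (nh_join X Y) f"
  shows "closedin M {s \<in> K. f s \<in> Inr ` topspace Y}"
proof (rule closedin_trans_full[OF _ K])
  have "{s \<in> topspace (subtopology M K). f s \<in> Inr ` topspace Y} = {s \<in> K. f s \<in> Inr ` topspace Y}"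
    using closedin_subset[OF K] by auto
  then show "closedin (subtopology M K) {s \<in> K. f s \<in> Inr ` topspace Y}"
    using closedin_continuous_map_preimage[OF f closedin_nh_join_right] by simp
qed

text \<open>
  The given map extends to a map \<open>f\<close> on a closed neighbourhood \<open>K\<close>.  Use \<open>f\<close> on an open set \<open>N\<close> inside
  \<open>K\<close> and a map \<open>g\<close> into \<open>Y\<close> outside.  Where the two differ on \<open>N\<close>, the values of \<open>f\<close> lie in \<open>X\<close>, hence
  below those of \<open>g\<close>.  So the preimage under the combined map of
  an open set that meets \<open>Y\<close> is the union of its preimages under the two maps, while an open set
  contained in \<open>X\<close> only has a preimage inside \<open>N\<close>.
\<close>

lemma absolute_extensor_nh_join_right:
  assumes M: "metrizable_space M" and X: "finite_t0_space X" and Y: "finite_t0_space Y"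
    and ae: "absolute_extensor_for M Y"
  shows "absolute_extensor_for M (nh_join X Y)"
  unfolding absolute_extensor_for_def
proof (intro allI impI)
  fix E0 f0 assume E0: "closedin M E0" and f0: "continuous_map (subtopology M E0) (nh_join X Y) f0"
  have finX: "finite (topspace X)" and finY: "finite (topspace Y)"
    using X Y by (simp_all add: finite_space_finite)
  note fin = finite_topspace_nh_join[OF finX finY]
  obtain N K f where N: "openin M N" and K: "closedin M K" and NK: "E0 \<subseteq> N" "N \<subseteq> K"
    and f: "continuous_map (subtopology M K) (nh_join X Y) f" and ff0: "\<And>s. s \<in> E0 \<Longrightarrow> f s = f0 s"
    using extends_to_closed_neighbourhood[OF M finite_t0_space_nh_join[OF X Y] E0 f0] by blast
  have KM: "K \<subseteq> topspace M" using K by (rule closedin_subset)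
  have fK: "f s \<in> topspace X <+> topspace Y" if "s \<in> K" for s
    using continuous_map_image_subset_topspace[OF f] that KM by (auto simp: topspace_nh_join)
  have fN: "continuous_map (subtopology M N) (nh_join X Y) f"
    using continuous_map_from_subtopology_mono[OF f NK(2)] .
  define E where "E = {s \<in> K. f s \<in> Inr ` topspace Y}"
  have E: "closedin M E" unfolding E_def using K f by (rule closedin_preimage_right)
  have fE: "continuous_map (subtopology M E) (nh_join X Y) f"
    by (rule continuous_map_from_subtopology_mono[OF f]) (auto simp: E_def)
  have "continuous_map (subtopology M E) Y (\<lambda>s. projr (f s))"
    by (rule continuous_map_projr[OF finX finY fE]) (simp add: E_def)
  then obtain g where g: "continuous_map M Y g" and gE: "\<And>s. s \<in> E \<Longrightarrow> g s = projr (f s)"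
    using ae E unfolding absolute_extensor_for_def has_extension_def by meson
  have gY: "g s \<in> topspace Y" if "s \<in> topspace M" for s
    using continuous_map_funspace[OF g] that by auto
  define F where "F s = (if s \<in> N then f s else Inr (g s))" for s
  have "continuous_map M (nh_join X Y) F"
  proof (rule continuous_map_into_nh_joinI[OF finX finY])
    show "F s \<in> topspace X <+> topspace Y" if "s \<in> topspace M" for s
      using that fK gY NK(2) by (auto simp: F_def)
    have openN: "openin M {s \<in> N. join_le X Y (f s) p}" if "p \<in> topspace X <+> topspace Y" for p
      using openin_below[OF fin N fN, of p] that by (simp add: topspace_nh_join space_le_nh_join)
    show "openin M {s \<in> topspace M. join_le X Y (F s) (Inl x)}" if "x \<in> topspace X" for x
    proof -
      have "{s \<in> topspace M. join_le X Y (F s) (Inl x)} = {s \<in> N. join_le X Y (f s) (Inl x)}"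
        using NK(2) KM by (auto simp: F_def)
      then show ?thesis using openN[OF InlI[OF that]] by simp
    qed
    show "openin M {s \<in> topspace M. join_le X Y (F s) (Inr y)}" if y: "y \<in> topspace Y" for y
    proof -
      have le: "join_le X Y (f s) (Inr y)" if "s \<in> N" "space_le Y (g s) y" for s
      proof (cases "f s")
        case (Inl a)
        then show ?thesis using fK[of s] NK(2) that(1) y by auto
      next
        case (Inr b)
        then have "s \<in> E" using fK[of s] NK(2) that(1) by (auto simp: E_def)
        then show ?thesis using gE that(2) Inr by simp
      qed
      have "{s \<in> topspace M. join_le X Y (F s) (Inr y)} =
          {s \<in> N. join_le X Y (f s) (Inr y)} \<union> {s \<in> topspace M. space_le Y (g s) y}"
        using NK(2) KM le by (auto simp: F_def)
      moreover have "openin M {s \<in> topspace M. space_le Y (g s) y}"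
        using g y unfolding continuous_map_into_finite_space[OF finY] by blast
      ultimately show ?thesis using openN[OF InrI[OF y]] by auto
    qed
  qed
  moreover have "F s = f0 s" if "s \<in> E0" for s using that NK(1) ff0 by (auto simp: F_def)
  ultimately show "has_extension M E0 (nh_join X Y) f0" unfolding has_extension_def by blast
qed

text \<open>
  The given map extends to a map \<open>f\<close> on a closed neighbourhood \<open>K\<close>.  Three maps are combined: \<open>f\<close> on
  an open set \<open>N\<close> inside \<open>K\<close>, a map \<open>h\<close> into \<open>Y\<close> on the rest of a
  closed neighbourhood \<open>L\<close> of the preimage \<open>E\<close> of \<open>Y\<close>, and a map \<open>g\<close> into \<open>X\<close> elsewhere.  Here \<open>h\<close>
  agrees with \<open>f\<close> on \<open>E\<close>, and \<open>g\<close> agrees with \<open>f\<close> on the part of \<open>K\<close> outside a smaller open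
  neighbourhood \<open>V\<close> of \<open>E\<close>.  On \<open>L\<close> the map \<open>h\<close> dominates both \<open>f\<close>, away from \<open>E\<close>, and \<open>g\<close>; the passage
  between \<open>f\<close> and \<open>g\<close> outside \<open>L\<close> involves no jump.
\<close>

lemma absolute_extensor_nh_join_left:
  assumes M: "metrizable_space M" and X: "finite_t0_space X" and Y: "finite_t0_space Y"
    and ae: "absolute_extensor_for M X"
  shows "absolute_extensor_for M (nh_join X Y)"
  unfolding absolute_extensor_for_def
proof (intro allI impI)
  fix E0 f0 assume E0: "closedin M E0" and f0: "continuous_map (subtopology M E0) (nh_join X Y) f0"
  have finX: "finite (topspace X)" and finY: "finite (topspace Y)"
    using X Y by (simp_all add: finite_space_finite)
  note fin = finite_topspace_nh_join[OF finX finY]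
  obtain N K f where N: "openin M N" and K: "closedin M K" and NK: "E0 \<subseteq> N" "N \<subseteq> K"
    and f: "continuous_map (subtopology M K) (nh_join X Y) f" and ff0: "\<And>s. s \<in> E0 \<Longrightarrow> f s = f0 s"
    using extends_to_closed_neighbourhood[OF M finite_t0_space_nh_join[OF X Y] E0 f0] by blast
  have KM: "K \<subseteq> topspace M" using K by (rule closedin_subset)
  have fK: "f s \<in> topspace X <+> topspace Y" if "s \<in> K" for s
    using continuous_map_image_subset_topspace[OF f] that KM by (auto simp: topspace_nh_join)
  have fN: "continuous_map (subtopology M N) (nh_join X Y) f"
    using continuous_map_from_subtopology_mono[OF f NK(2)] .
  define E where "E = {s \<in> K. f s \<in> Inr ` topspace Y}"
  have E: "closedin M E" unfolding E_def using K f by (rule closedin_preimage_right)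
  have fE: "continuous_map (subtopology M E) (nh_join X Y) f"
    by (rule continuous_map_from_subtopology_mono[OF f]) (auto simp: E_def)
  have projr: "continuous_map (subtopology M E) Y (\<lambda>s. projr (f s))"
    by (rule continuous_map_projr[OF finX finY fE]) (simp add: E_def)
  obtain V L h where V: "openin M V" and L: "closedin M L" and VL: "E \<subseteq> V" "V \<subseteq> L"
    and h: "continuous_map (subtopology M L) Y h" and hE: "\<And>s. s \<in> E \<Longrightarrow> h s = projr (f s)"
    using extends_to_closed_neighbourhood[OF M Y E projr] by blast
  have LM: "L \<subseteq> topspace M" using L by (rule closedin_subset)
  have hY: "h s \<in> topspace Y" if "s \<in> L" for s
    using continuous_map_image_subset_topspace[OF h] that LM by auto
  have KV: "closedin M (K - V)" using K V by (rule closedin_diff)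
  have left: "f s \<in> Inl ` topspace X" if "s \<in> K" "s \<notin> V" for s
    using fK[OF that(1)] that VL(1) by (auto simp: E_def)
  have "continuous_map (subtopology M (K - V)) (nh_join X Y) f"
    by (rule continuous_map_from_subtopology_mono[OF f]) auto
  then have "continuous_map (subtopology M (K - V)) X (\<lambda>s. projl (f s))"
    by (rule continuous_map_projl[OF finX finY]) (use left in auto)
  then obtain g where g: "continuous_map M X g" and gK: "\<And>s. s \<in> K - V \<Longrightarrow> g s = projl (f s)"
    using ae KV unfolding absolute_extensor_for_def has_extension_def by meson
  have gX: "g s \<in> topspace X" if "s \<in> topspace M" for s
    using continuous_map_funspace[OF g] that by auto
  have fg: "f s = Inl (g s)" if "s \<in> K" "s \<notin> V" for s
    using left[OF that] gK[of s] that by auto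
  have fh: "f s = Inr (h s)" if "s \<in> E" for s
    using hE[OF that] that by (auto simp: E_def)
  define F where "F s = (if s \<in> N then f s else if s \<in> L then Inr (h s) else Inl (g s))" for s
  have "continuous_map M (nh_join X Y) F"
  proof (rule continuous_map_into_nh_joinI[OF finX finY])
    show "F s \<in> topspace X <+> topspace Y" if "s \<in> topspace M" for s
      using that fK gX hY NK(2) by (auto simp: F_def)
    have openN: "openin M {s \<in> N. join_le X Y (f s) p}" if "p \<in> topspace X <+> topspace Y" for p
      using openin_below[OF fin N fN, of p] that by (simp add: topspace_nh_join space_le_nh_join)
    show "openin M {s \<in> topspace M. join_le X Y (F s) (Inl x)}" if x: "x \<in> topspace X" for x
    proof -
      have fgN: "f s = Inl (g s)" if "s \<in> N" "s \<notin> L" for s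
        using fg[of s] that NK(2) VL(2) by blast
      have "{s \<in> topspace M. join_le X Y (F s) (Inl x)} =
          {s \<in> N. join_le X Y (f s) (Inl x)} \<union> ({s \<in> topspace M. space_le X (g s) x} - L)"
        using NK(2) KM fgN by (auto simp: F_def split: if_splits)
      moreover have "openin M {s \<in> topspace M. space_le X (g s) x}"
        using g x unfolding continuous_map_into_finite_space[OF finX] by blast
      ultimately show ?thesis using openN[OF InlI[OF x]] L by auto
    qed
    show "openin M {s \<in> topspace M. join_le X Y (F s) (Inr y)}" if y: "y \<in> topspace Y" for y
    proof -
      let ?A = "{s \<in> K. \<not> join_le X Y (f s) (Inr y)}" and ?B = "{s \<in> L. \<not> space_le Y (h s) y}"
      have "closedin M ?A"
        using closedin_not_below[OF fin K f, unfolded topspace_nh_join space_le_nh_join, OF InrI[OF y]] .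
      moreover have "closedin M ?B" using closedin_not_below[OF finY L h y] .
      \<comment> \<open>An open set that meets \<open>Y\<close> contains \<open>X\<close>, so only \<open>f\<close> and \<open>h\<close> can leave it, and they do so on
        closed sets.\<close>
      ultimately have op: "openin M (topspace M - (?A \<union> ?B))" by blast
      have "{s \<in> topspace M. join_le X Y (F s) (Inr y)} =
          {s \<in> N. join_le X Y (f s) (Inr y)} \<union> (topspace M - (?A \<union> ?B))"
      proof (intro Set.set_eqI iffI)
        fix s assume s: "s \<in> {s \<in> topspace M. join_le X Y (F s) (Inr y)}"
        show "s \<in> {s \<in> N. join_le X Y (f s) (Inr y)} \<union> (topspace M - (?A \<union> ?B))"
        proof (cases "s \<in> N")
          case True
          then show ?thesis using s by (simp add: F_def)
        next
          case False
          have "s \<notin> ?B" using s False by (auto simp: F_def)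
          moreover have "join_le X Y (f s) (Inr y)" if "s \<in> K"
          proof (cases "f s")
            case (Inl a)
            then show ?thesis using fK[OF that] y by auto
          next
            case (Inr b)
            then have "s \<in> E" using fK[OF that] that by (auto simp: E_def)
            then show ?thesis using fh[of s] s False VL by (auto simp: F_def)
          qed
          ultimately show ?thesis using s by auto
        qed
      next
        fix s assume s: "s \<in> {s \<in> N. join_le X Y (f s) (Inr y)} \<union> (topspace M - (?A \<union> ?B))"
        then show "s \<in> {s \<in> topspace M. join_le X Y (F s) (Inr y)}"
          using NK(2) KM gX y by (auto simp: F_def)
      qed
      then show ?thesis using openN[OF InrI[OF y]] op by auto
    qed
  qed
  moreover have "F s = f0 s" if "s \<in> E0" for s using that NK(1) ff0 by (auto simp: F_def)
  ultimately show "has_extension M E0 (nh_join X Y) f0" unfolding has_extension_def by blast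
qed

lemma homotopically_trivial_nh_join:
  assumes X: "finite_t0_space X" and Y: "finite_t0_space Y"
    and "homotopically_trivial X \<or> homotopically_trivial Y"
  shows "homotopically_trivial (nh_join X Y)"
proof (rule absolute_extensor_imp_homotopically_trivial)
  fix n
  have M: "metrizable_space (cube n)" by (simp add: cube_eq_icube metrizable_icube)
  from assms(3) show "absolute_extensor_for (cube n) (nh_join X Y)"
  proof
    assume "homotopically_trivial X"
    then show ?thesis
      using absolute_extensor_nh_join_left[OF M X Y] homotopically_trivial_imp_absolute_extensor[OF X]
      by simp
  next
    assume "homotopically_trivial Y"
    then show ?thesis
      using absolute_extensor_nh_join_right[OF M X Y] homotopically_trivial_imp_absolute_extensor[OF Y]
      by simp
  qed
qed

text \<open>
  Constant maps extend.
\<close>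

lemma homotopically_trivial_point:
  assumes "topspace Z = {z}"
  shows "homotopically_trivial Z"
proof (rule absolute_extensor_imp_homotopically_trivial)
  fix n
  show "absolute_extensor_for (cube n) Z"
    unfolding absolute_extensor_for_def has_extension_def
  proof (intro allI impI)
    fix E f assume E: "closedin (cube n) E" and f: "continuous_map (subtopology (cube n) E) Z f"
    have "f s = z" if "s \<in> E" for s
      using continuous_map_image_subset_topspace[OF f] closedin_subset[OF E] that assms by auto
    then show "\<exists>F. continuous_map (cube n) Z F \<and> (\<forall>s\<in>E. F s = f s)"
      using assms by (intro exI[of _ "\<lambda>_. z"]) auto
  qed
qed

section \<open>Links and collapses of joins\<close>

lemma space_le_subtopology:
  "space_le (subtopology X S) a b \<longleftrightarrow> a \<in> S \<and> b \<in> S \<and> space_le X a b"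
proof (cases "b \<in> S \<and> b \<in> topspace X")
  case True
  have "{U. openin (subtopology X S) U \<and> b \<in> U} = (\<lambda>U. U \<inter> S) ` {U. openin X U \<and> b \<in> U}"
    using True by (auto simp: openin_subtopology)
  then have "min_open (subtopology X S) b = \<Inter>((\<lambda>U. U \<inter> S) ` {U. openin X U \<and> b \<in> U})"
    by (simp add: min_open_def)
  also have "\<dots> = min_open X b \<inter> S"
    using True unfolding min_open_def by blast
  finally show ?thesis using True by (auto simp: space_le_def)
qed (auto simp: space_le_def)

lemma finite_t0_space_subtopology:
  assumes "finite_t0_space X"
  shows "finite_t0_space (subtopology X S)"
proof (rule finite_t0_spaceI)
  show "finite (topspace (subtopology X S))" using assms by (simp add: finite_t0_space_def)
  show "p = q" if "space_le (subtopology X S) p q" "space_le (subtopology X S) q p" for p q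
    using that space_le_antisym[OF assms] unfolding space_le_subtopology by blast
qed

lemma finite_space_eqI:
  assumes "finite (topspace X)" "topspace X = topspace Y" "\<And>p q. space_le X p q \<longleftrightarrow> space_le Y p q"
  shows "X = Y"
proof -
  have "finite (topspace Y)" using assms(1,2) by simp
  then show ?thesis
    unfolding topology_eq openin_finite_space_iff[OF assms(1)] openin_finite_space_iff[OF \<open>finite (topspace Y)\<close>]
    by (simp only: assms(2,3)) simp
qed

lemma nh_join_subtopology:
  assumes "finite (topspace X)" "finite (topspace Y)"
  shows "subtopology (nh_join X Y) (S <+> T) = nh_join (subtopology X S) (subtopology Y T)"
proof (rule finite_space_eqI)
  show "finite (topspace (subtopology (nh_join X Y) (S <+> T)))"
    using finite_topspace_nh_join[OF assms] by simp
  show "topspace (subtopology (nh_join X Y) (S <+> T)) = topspace (nh_join (subtopology X S) (subtopology Y T))"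
    by (auto simp: topspace_nh_join)
  show "space_le (subtopology (nh_join X Y) (S <+> T)) p q \<longleftrightarrow>
      space_le (nh_join (subtopology X S) (subtopology Y T)) p q" for p q
    by (cases p; cases q) (auto simp: space_le_nh_join space_le_subtopology)
qed

lemma link_nh_join_Inl:
  assumes "finite (topspace X)" "finite (topspace Y)" "x \<in> topspace X"
  shows "link (nh_join X Y) (Inl x) = nh_join (link X x) Y"
proof -
  have "{p \<in> topspace (nh_join X Y). p \<noteq> Inl x \<and>
          (space_le (nh_join X Y) p (Inl x) \<or> space_le (nh_join X Y) (Inl x) p)} =
        {a \<in> topspace X. a \<noteq> x \<and> (space_le X a x \<or> space_le X x a)} <+> topspace Y"
    using assms(3) by (auto simp: space_le_nh_join topspace_nh_join)
  then show ?thesis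
    using nh_join_subtopology[OF assms(1,2), of _ "topspace Y"] by (simp add: link_def)
qed

lemma link_nh_join_Inr:
  assumes "finite (topspace X)" "finite (topspace Y)" "y \<in> topspace Y"
  shows "link (nh_join X Y) (Inr y) = nh_join X (link Y y)"
proof -
  have "{p \<in> topspace (nh_join X Y). p \<noteq> Inr y \<and>
          (space_le (nh_join X Y) p (Inr y) \<or> space_le (nh_join X Y) (Inr y) p)} =
        topspace X <+> {b \<in> topspace Y. b \<noteq> y \<and> (space_le Y b y \<or> space_le Y y b)}"
    using assms(3) by (auto simp: space_le_nh_join topspace_nh_join)
  then show ?thesis
    using nh_join_subtopology[OF assms(1,2), of "topspace X"] by (simp add: link_def)
qed

lemma finite_t0_space_link: "finite_t0_space X \<Longrightarrow> finite_t0_space (link X x)"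
  by (simp add: link_def finite_t0_space_subtopology)

text \<open>
  Since the link of \<open>x\<close> in the join is the join of \<open>link X x\<close> and \<open>Y\<close>, there are two ways for \<open>x\<close> to be
  a \<open>\<gamma>\<close>-point of the join: it is one of \<open>X\<close>, or \<open>Y\<close> is homotopically trivial.  The former transfers
  collapses of \<open>X\<close> to the join, the latter removes all of \<open>X\<close> from the join.
\<close>

lemma elementary_collapse_nh_join_Inl:
  assumes X: "finite_t0_space X" and Y: "finite_t0_space Y" and x: "x \<in> topspace X"
    and tr: "homotopically_trivial (link X x) \<or> homotopically_trivial Y"
  shows "elementary_gamma_collapse (nh_join X Y) (nh_join (subtopology X (topspace X - {x})) Y)"
proof -
  have fin: "finite (topspace X)" "finite (topspace Y)" using X Y by (simp_all add: finite_space_finite)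
  have "gamma_point (nh_join X Y) (Inl x)"
    unfolding gamma_point_def link_nh_join_Inl[OF fin x] topspace_nh_join
    using x homotopically_trivial_nh_join[OF finite_t0_space_link[OF X] Y tr] by blast
  moreover have "topspace (nh_join X Y) - {Inl x} = (topspace X - {x}) <+> topspace Y"
    by (auto simp: topspace_nh_join)
  ultimately show ?thesis
    unfolding elementary_gamma_collapse_def
    using nh_join_subtopology[OF fin, of _ "topspace Y"] by (intro exI[of _ "Inl x"]) simp
qed

lemma elementary_collapse_nh_join_Inr:
  assumes X: "finite_t0_space X" and Y: "finite_t0_space Y" and y: "y \<in> topspace Y"
    and tr: "homotopically_trivial X \<or> homotopically_trivial (link Y y)"
  shows "elementary_gamma_collapse (nh_join X Y) (nh_join X (subtopology Y (topspace Y - {y})))"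
proof -
  have fin: "finite (topspace X)" "finite (topspace Y)" using X Y by (simp_all add: finite_space_finite)
  have "gamma_point (nh_join X Y) (Inr y)"
    unfolding gamma_point_def link_nh_join_Inr[OF fin y] topspace_nh_join
    using y homotopically_trivial_nh_join[OF X finite_t0_space_link[OF Y] tr] by blast
  moreover have "topspace (nh_join X Y) - {Inr y} = topspace X <+> (topspace Y - {y})"
    by (auto simp: topspace_nh_join)
  ultimately show ?thesis
    unfolding elementary_gamma_collapse_def
    using nh_join_subtopology[OF fin, of "topspace X"] by (intro exI[of _ "Inr y"]) simp
qed

lemma gamma_collapses_nh_join_left:
  assumes "gamma_collapses X Z" and X: "finite_t0_space X" and Y: "finite_t0_space Y"
  shows "finite_t0_space Z \<and> gamma_collapses (nh_join X Y) (nh_join Z Y)"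
  using assms(1) unfolding gamma_collapses_def
proof (induction rule: rtranclp_induct)
  case base
  then show ?case using X by simp
next
  case (step Z Z')
  then obtain x where x: "gamma_point Z x" "Z' = subtopology Z (topspace Z - {x})"
    unfolding elementary_gamma_collapse_def by blast
  have Z: "finite_t0_space Z" using step.IH by simp
  have "elementary_gamma_collapse (nh_join Z Y) (nh_join Z' Y)"
    using elementary_collapse_nh_join_Inl[OF Z Y] x unfolding gamma_point_def by simp
  moreover have "finite_t0_space Z'" unfolding x(2) using Z by (rule finite_t0_space_subtopology)
  ultimately show ?case using step.IH rtranclp.rtrancl_into_rtrancl by force
qed

lemma gamma_collapses_nh_join_right:
  assumes "gamma_collapses Y Z" and X: "finite_t0_space X" and Y: "finite_t0_space Y"
  shows "finite_t0_space Z \<and> gamma_collapses (nh_join X Y) (nh_join X Z)"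
  using assms(1) unfolding gamma_collapses_def
proof (induction rule: rtranclp_induct)
  case base
  then show ?case using Y by simp
next
  case (step Z Z')
  then obtain y where y: "gamma_point Z y" "Z' = subtopology Z (topspace Z - {y})"
    unfolding elementary_gamma_collapse_def by blast
  have Z: "finite_t0_space Z" using step.IH by simp
  have "elementary_gamma_collapse (nh_join X Z) (nh_join X Z')"
    using elementary_collapse_nh_join_Inr[OF X Z] y unfolding gamma_point_def by simp
  moreover have "finite_t0_space Z'" unfolding y(2) using Z by (rule finite_t0_space_subtopology)
  ultimately show ?case using step.IH rtranclp.rtrancl_into_rtrancl by force
qed

text \<open>
  If \<open>X\<close> is homotopically trivial, every point of \<open>Y\<close> is a \<open>\<gamma>\<close>-point of the join, and remains one
  after the removal of other points of \<open>Y\<close>.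
\<close>

lemma gamma_collapses_emptying_right:
  assumes X: "finite_t0_space X" and tr: "homotopically_trivial X"
  shows "finite_t0_space Y \<Longrightarrow> \<exists>W. topspace W = {} \<and> gamma_collapses (nh_join X Y) (nh_join X W)"
proof (induction "card (topspace Y)" arbitrary: Y)
  case 0
  then have "topspace Y = {}" by (simp add: finite_t0_space_def)
  then show ?case unfolding gamma_collapses_def by blast
next
  case (Suc n)
  then obtain y where y: "y \<in> topspace Y" by fastforce
  let ?Y = "subtopology Y (topspace Y - {y})"
  have "n = card (topspace ?Y)" using Suc.hyps(2) y Suc.prems
    by (simp add: Int_absorb1 finite_t0_space_def card_Diff_singleton)
  then obtain W where "topspace W = {}" "gamma_collapses (nh_join X ?Y) (nh_join X W)"
    using Suc.hyps(1)[of ?Y] Suc.prems finite_t0_space_subtopology by blast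
  moreover have "elementary_gamma_collapse (nh_join X Y) (nh_join X ?Y)"
    using elementary_collapse_nh_join_Inr[OF X Suc.prems y] tr by blast
  ultimately show ?case unfolding gamma_collapses_def by (meson converse_rtranclp_into_rtranclp)
qed

lemma gamma_collapses_emptying_left:
  assumes Y: "finite_t0_space Y" and tr: "homotopically_trivial Y"
  shows "finite_t0_space X \<Longrightarrow> \<exists>W. topspace W = {} \<and> gamma_collapses (nh_join X Y) (nh_join W Y)"
proof (induction "card (topspace X)" arbitrary: X)
  case 0
  then have "topspace X = {}" by (simp add: finite_t0_space_def)
  then show ?case unfolding gamma_collapses_def by blast
next
  case (Suc n)
  then obtain x where x: "x \<in> topspace X" by fastforce
  let ?X = "subtopology X (topspace X - {x})"
  have "n = card (topspace ?X)" using Suc.hyps(2) x Suc.prems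
    by (simp add: Int_absorb1 finite_t0_space_def card_Diff_singleton)
  then obtain W where "topspace W = {}" "gamma_collapses (nh_join ?X Y) (nh_join W Y)"
    using Suc.hyps(1)[of ?X] Suc.prems finite_t0_space_subtopology by blast
  moreover have "elementary_gamma_collapse (nh_join X Y) (nh_join ?X Y)"
    using elementary_collapse_nh_join_Inl[OF Suc.prems Y x] tr by blast
  ultimately show ?case unfolding gamma_collapses_def by (meson converse_rtranclp_into_rtranclp)
qed

lemma gamma_collapsible_nh_join_left:
  assumes X: "finite_t0_space X" and Y: "finite_t0_space Y" and "gamma_collapsible X"
  shows "gamma_collapsible (nh_join X Y)"
proof -
  obtain Z x where Z: "gamma_collapses X Z" "topspace Z = {x}"
    using assms(3) unfolding gamma_collapsible_def by blast
  have 1: "finite_t0_space Z" "gamma_collapses (nh_join X Y) (nh_join Z Y)"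
    using gamma_collapses_nh_join_left[OF Z(1) X Y] by auto
  obtain W where W: "topspace W = {}" "gamma_collapses (nh_join Z Y) (nh_join Z W)"
    using gamma_collapses_emptying_right[OF 1(1) homotopically_trivial_point[OF Z(2)] Y] by blast
  have "gamma_collapses (nh_join X Y) (nh_join Z W)"
    using 1(2) W(2) unfolding gamma_collapses_def by (rule rtranclp_trans)
  moreover have "topspace (nh_join Z W) = {Inl x}"
    using Z(2) W(1) by (auto simp: topspace_nh_join)
  ultimately show ?thesis unfolding gamma_collapsible_def by blast
qed

lemma gamma_collapsible_nh_join_right:
  assumes X: "finite_t0_space X" and Y: "finite_t0_space Y" and "gamma_collapsible Y"
  shows "gamma_collapsible (nh_join X Y)"
proof -
  obtain Z y where Z: "gamma_collapses Y Z" "topspace Z = {y}"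
    using assms(3) unfolding gamma_collapsible_def by blast
  have 1: "finite_t0_space Z" "gamma_collapses (nh_join X Y) (nh_join X Z)"
    using gamma_collapses_nh_join_right[OF Z(1) X Y] by auto
  obtain W where W: "topspace W = {}" "gamma_collapses (nh_join X Z) (nh_join W Z)"
    using gamma_collapses_emptying_left[OF 1(1) homotopically_trivial_point[OF Z(2)] X] by blast
  have "gamma_collapses (nh_join X Y) (nh_join W Z)"
    using 1(2) W(2) unfolding gamma_collapses_def by (rule rtranclp_trans)
  moreover have "topspace (nh_join W Z) = {Inr y}"
    using Z(2) W(1) by (auto simp: topspace_nh_join)
  ultimately show ?thesis unfolding gamma_collapsible_def by blast
qed

theorem proposition3p17:
  fixes X :: "'a topology" and Y :: "'b topology"
  assumes "finite_t0_space X" and "finite_t0_space Y"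
  shows "(homotopically_trivial X \<or> homotopically_trivial Y
            \<longrightarrow> homotopically_trivial (nh_join X Y))
       \<and> (gamma_collapsible X \<or> gamma_collapsible Y
            \<longrightarrow> gamma_collapsible (nh_join X Y))"
  using homotopically_trivial_nh_join[OF assms] gamma_collapsible_nh_join_left[OF assms]
    gamma_collapsible_nh_join_right[OF assms] by blast

end
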